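(* There exists a strictly increasing sequence of integers $\{m_n\}_{n=1}^\infty\subseteq\mathbb N$ satisfying $2^{n/10}\le m_n\le2^n$ for all $n\in\mathbb N$, with the following properties. For every $\delta\in(0,1]$ there is $n_0(\delta)\in\mathbb N$ and a sequence of regular graphs $\{H_n(\delta)\}_{n=n_0(\delta)}^\infty$ such that: \begin{itemize} \item $|V(H_n(\delta))|=m_n$ for every integer $n\ge n_0(\delta)$. \item For every integer $n\ge n_0(\delta)$ the degree of $H_n(\delta)$, denoted $d_n(\delta)$, satisfies $d_n(\delta)\le e^{(\log m_n)^{1-\delta}}$. \item For every $K$-convex Banach space $(X,\|\cdot\|_X)$ we have $\gamma_+(H_n(\delta),\|\cdot\|_X^2)<\infty$ for all $\delta\in(0,1)$ and all integers $n\ge n_0(\delta)$. Moreover, there exists $\delta_0(X)\in(0,1)$ such that $$\forall\,\delta\in(0,\delta_0(X)],\ \forall\,n\in[n_0(\delta),\infty)\cap\mathbb N,\quad\gamma_+(H_n(\delta),\|\cdot\|_X^2)\le9^3 .$$ \end{itemize}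
   Context: Graphs are finite and undirected, with self loops and multiple edges allowed: a graph $G=(V,E)$ consists of a finite set $V=V(G)$ and nonnegative integers $E(u,v)=E(v,u)$. The degree of $u$ is $\sum_vE(u,v)$ (each self loop contributes $1$); $G$ is $d$-regular if all degrees equal $d$; its normalized adjacency matrix is $A_G=(E(u,v)/d)_{u,v}$. The graphs $H_n(\delta)$ do not depend on $X$. For a symmetric $K:X\times X\to[0,\infty)$ and an $n\times n$ symmetric stochastic matrix $A=(a_{ij})$, $\gamma_+(A,K)\in[0,\infty]$ is the infimum over those $\gamma_+>0$ such that for all $x_1,\ldots,x_n,y_1,\ldots,y_n\in X$, $$\frac1{n^2}\sum_{i,j=1}^nK(x_i,y_j)\le\frac{\gamma_+}{n}\sum_{i,j=1}^na_{ij}K(x_i,y_j)$$ ($\infty$ if there is no finite such $\gamma_+$). For a regular graph $G$, $\gamma_+(G,K)=\gamma_+(A_G,K)$; $\|\cdot\|_X^2$ stands for the kernel $K(x,y)=\|x-y\|_X^2$. $K$-convexity: for $f:\mathbb F_2^n\to X$ let $\mathrm{Rad}(f)=\sum_{j=1}^n\hat f(\{j\})W_{\{j\}}$, where $W_{\{j\}}(x)=(-1)^{x_j}$ and $\hat f(\{j\})=2^{-n}\sum_{x\in\mathbb F_2^n}f(x)W_{\{j\}}(x)$. Let $K(X)=\sup_{n\in\mathbb N}\|\mathrm{Rad}\|_{L_2(\mathbb F_2^n,X)\to L_2(\mathbb F_2^n,X)}$, where $L_2(\mathbb F_2^n,X)$ is taken with respect to the normalized counting measure. $X$ is $K$-convex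 if $K(X)<\infty$. *)

theory Defs
  imports "HOL-Analysis.Analysis" "HOL-Analysis.Finite_Function_Topology"
begin

record 'v mgraph =
  verts :: "'v set"
  edges :: "'v \<Rightarrow> 'v \<Rightarrow> nat"

definition is_mgraph :: "'v mgraph \<Rightarrow> bool" where
  "is_mgraph G \<longleftrightarrow>
     finite (verts G) \<and> (\<forall>u\<in>verts G. \<forall>v\<in>verts G. edges G u v = edges G v u)"

definition vdegree :: "'v mgraph \<Rightarrow> 'v \<Rightarrow> nat" where
  "vdegree G u = (\<Sum>v\<in>verts G. edges G u v)"

definition regular_of_degree :: "nat \<Rightarrow> 'v mgraph \<Rightarrow> bool" where
  "regular_of_degree d G \<longleftrightarrow> is_mgraph G \<and> (\<forall>u\<in>verts G. vdegree G u = d)"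

text \<open>Only used for regular graphs, where the denominator does not depend on the row.\<close>

definition norm_adj :: "'v mgraph \<Rightarrow> 'v \<Rightarrow> 'v \<Rightarrow> real" where
  "norm_adj G u v = real (edges G u v) / real (vdegree G u)"

text \<open>The rows and columns of the matrix \<open>A\<close> are indexed by a finite set \<open>I\<close>, so \<open>n = card I\<close>; the
  kernel \<open>K\<close> lives on the set \<open>X\<close>. In \<^typ>\<open>ereal\<close> the infimum of the empty set is \<open>\<infinity>\<close>.\<close>

definition gamma_plus ::
    "'i set \<Rightarrow> ('i \<Rightarrow> 'i \<Rightarrow> real) \<Rightarrow> 'x set \<Rightarrow> ('x \<Rightarrow> 'x \<Rightarrow> real) \<Rightarrow> ereal" where
  "gamma_plus I A X K = Inf {ereal g | g. 0 < g \<and>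
     (\<forall>x\<in>I \<rightarrow> X. \<forall>y\<in>I \<rightarrow> X.
        1 / (real (card I))\<^sup>2 * (\<Sum>i\<in>I. \<Sum>j\<in>I. K (x i) (y j))
          \<le> g / real (card I) * (\<Sum>i\<in>I. \<Sum>j\<in>I. A i j * K (x i) (y j)))}"

definition gamma_plus_graph :: "'v mgraph \<Rightarrow> 'x set \<Rightarrow> ('x \<Rightarrow> 'x \<Rightarrow> real) \<Rightarrow> ereal" where
  "gamma_plus_graph G X K = gamma_plus (verts G) (norm_adj G) X K"

text \<open>A Banach space is a linear subspace \<open>S\<close> of an ambient real vector space (whose type carries no
  norm), together with a complete norm \<open>p\<close> on \<open>S\<close>. In contrast to a type of class
  \<^class>\<open>banach\<close>, such a pair can be quantified over inside a formula.\<close>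

locale banach_on =
  fixes S :: "'v::real_vector set" and p :: "'v \<Rightarrow> real"
  assumes subspace: "subspace S"
    and norm_nonneg: "x \<in> S \<Longrightarrow> 0 \<le> p x"
    and norm_eq_0: "x \<in> S \<Longrightarrow> p x = 0 \<longleftrightarrow> x = 0"
    and norm_scale: "x \<in> S \<Longrightarrow> p (a *\<^sub>R x) = \<bar>a\<bar> * p x"
    and norm_triangle: "x \<in> S \<Longrightarrow> y \<in> S \<Longrightarrow> p (x + y) \<le> p x + p y"
    and complete:
      "\<lbrakk>\<And>k. f k \<in> S; \<And>e. 0 < e \<Longrightarrow> \<exists>N. \<forall>i\<ge>N. \<forall>j\<ge>N. p (f i - f j) < e\<rbrakk>
         \<Longrightarrow> \<exists>l\<in>S. (\<lambda>k. p (f k - l)) \<longlonglongrightarrow> 0"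

lemma banach_on_UNIV: "banach_on (UNIV :: 'a::banach set) norm"
proof
  fix f :: "nat \<Rightarrow> 'a"
  assume "\<And>e. 0 < e \<Longrightarrow> \<exists>N. \<forall>i\<ge>N. \<forall>j\<ge>N. norm (f i - f j) < e"
  then have "Cauchy f"
    by (simp add: Cauchy_iff)
  then obtain l where "f \<longlonglongrightarrow> l"
    by (auto simp: Cauchy_convergent_iff convergent_def)
  then show "\<exists>l\<in>UNIV. (\<lambda>k. norm (f k - l)) \<longlonglongrightarrow> 0"
    by (intro bexI[of _ l]) (simp_all add: tendsto_norm_zero LIM_zero)
qed (auto intro: norm_triangle_ineq)

definition cube :: "nat \<Rightarrow> (nat \<Rightarrow> nat) set" where
  "cube n = {..<n} \<rightarrow>\<^sub>E {0, 1}"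

definition walsh :: "nat \<Rightarrow> (nat \<Rightarrow> nat) \<Rightarrow> real" where
  "walsh j x = (- 1) ^ x j"

definition fourier :: "nat \<Rightarrow> ((nat \<Rightarrow> nat) \<Rightarrow> 'v::real_vector) \<Rightarrow> nat \<Rightarrow> 'v" where
  "fourier n f j = (1 / 2 ^ n) *\<^sub>R (\<Sum>x\<in>cube n. walsh j x *\<^sub>R f x)"

definition Rad :: "nat \<Rightarrow> ((nat \<Rightarrow> nat) \<Rightarrow> 'v::real_vector) \<Rightarrow> (nat \<Rightarrow> nat) \<Rightarrow> 'v" where
  "Rad n f x = (\<Sum>j<n. walsh j x *\<^sub>R fourier n f j)"

definition L2norm :: "nat \<Rightarrow> ('v \<Rightarrow> real) \<Rightarrow> ((nat \<Rightarrow> nat) \<Rightarrow> 'v) \<Rightarrow> real" where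
  "L2norm n p f = sqrt (1 / 2 ^ n * (\<Sum>x\<in>cube n. (p (f x))\<^sup>2))"

text \<open>The inner supremum is the operator norm of \<^const>\<open>Rad\<close>; functions of norm zero contribute
  \<open>0 / 0 = 0\<close>.\<close>

definition K_const :: "'v::real_vector set \<Rightarrow> ('v \<Rightarrow> real) \<Rightarrow> ereal" where
  "K_const S p =
     (SUP n\<in>{1..}. SUP f\<in>cube n \<rightarrow> S. ereal (L2norm n p (Rad n f) / L2norm n p f))"

definition K_convex :: "'v::real_vector set \<Rightarrow> ('v \<Rightarrow> real) \<Rightarrow> bool" where
  "K_convex S p \<longleftrightarrow> K_const S p < \<infinity>"

definition graph_family ::
    "(nat \<Rightarrow> nat) \<Rightarrow> (real \<Rightarrow> nat) \<Rightarrow> (real \<Rightarrow> nat \<Rightarrow> nat mgraph) \<Rightarrow> bool" where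
  "graph_family m n0 H \<longleftrightarrow>
     strict_mono_on {1..} m \<and>
     (\<forall>n\<ge>1. 2 powr (real n / 10) \<le> real (m n) \<and> m n \<le> 2 ^ n) \<and>
     (\<forall>\<delta>\<in>{0<..1}. 1 \<le> n0 \<delta> \<and>
        (\<forall>n\<ge>n0 \<delta>. card (verts (H \<delta> n)) = m n \<and>
           (\<exists>d. regular_of_degree d (H \<delta> n) \<and>
                real d \<le> exp (ln (real (m n)) powr (1 - \<delta>)))))"

definition gap_bounds ::
    "(real \<Rightarrow> nat) \<Rightarrow> (real \<Rightarrow> nat \<Rightarrow> nat mgraph) \<Rightarrow> 'v::real_vector set \<Rightarrow> ('v \<Rightarrow> real) \<Rightarrow> bool" where
  "gap_bounds n0 H S p \<longleftrightarrow>
     (\<forall>\<delta>\<in>{0<..<1}. \<forall>n\<ge>n0 \<delta>. gamma_plus_graph (H \<delta> n) S (\<lambda>x y. (p (x - y))\<^sup>2) < \<infinity>) \<and>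
     (\<exists>\<delta>0\<in>{0<..<1}. \<forall>\<delta>\<in>{0<..\<delta>0}. \<forall>n\<ge>n0 \<delta>.
        gamma_plus_graph (H \<delta> n) S (\<lambda>x y. (p (x - y))\<^sup>2) \<le> 9 ^ 3)"

text \<open>The vector space \<^typ>\<open>real \<Rightarrow>\<^sub>0 real\<close> of finitely supported functions has
  dimension continuum, so its subspaces with complete norms include, up to isometry, all separable
  Banach spaces. The predicate below is monomorphic. This allows one graph sequence to serve the
  Banach spaces of all types: \<open>\<exists>s. \<forall>types. P s\<close> is rendered as \<open>(\<exists>s. Q s) \<and> (\<forall>s. Q s \<longrightarrow> P s)\<close>, where
  \<open>Q\<close> is \<open>good_family\<close> and the type variable occurs in \<open>P\<close> only.\<close>

definition good_family ::
    "(nat \<Rightarrow> nat) \<Rightarrow> (real \<Rightarrow> nat) \<Rightarrow> (real \<Rightarrow> nat \<Rightarrow> nat mgraph) \<Rightarrow> bool" where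
  "good_family m n0 H \<longleftrightarrow> graph_family m n0 H \<and>
     (\<forall>(S :: (real \<Rightarrow>\<^sub>0 real) set) p. banach_on S p \<longrightarrow> K_convex S p \<longrightarrow> gap_bounds n0 H S p)"

end

theory Submission
  imports Defs "HOL-Real_Asymp.Real_Asymp"
begin

text \<open>The graphs are the lazy Cayley graphs of \<open>{0, 1}\<^sup>n\<close> generated by the \<open>3 n\<close> columns of a generator matrix of a
  good linear code, raised to a power \<open>r\<close>. Their normalized adjacency matrix is \<open>Q\<^sup>r\<close>, where \<open>Q\<close>
  is an average of commuting idempotent contractions (conditional expectations) on \<open>L\<^sub>2(X)\<close>.
  \<open>K\<close>-convexity forces \<open>(I - Q\<^sup>s) Q\<^sup>s\<^sup>x\<close> to have norm at most \<open>1/32\<close> for all \<open>s\<close>, with \<open>x\<close> depending only on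
  \<open>K(X)\<close>: otherwise the differences of conditional expectations would span a large copy of
  \<open>l\<^sub>1\<close>. On mean zero functions \<open>Q\<^sup>R\<close> is exponentially small in \<open>n\<close> for \<open>R\<close> of order \<open>n\<close>, by the
  Fourier expansion. The bound at all scales \<open>s\<close> propagates smallness from \<open>R\<close> to \<open>\<rho> R\<close> with
  \<open>\<rho> < 1\<close>, at the price of halving the exponent, and \<open>log\<^sub>2 n\<close> such steps lead to contraction for
  \<open>R\<close> of order \<open>n\<close> to the power \<open>1 - \<beta>\<close>, with \<open>\<beta> > 0\<close> depending on \<open>X\<close>.

  A good family for the spaces inside \<^typ>\<open>real \<Rightarrow>\<^sub>0 real\<close> is good for all types since a
  violation of the bounds involves only countably many points, which lie in a separable subspace.\<close>

section \<open>Averages of commuting involutions\<close>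

text \<open>The obstacle is the degree. Walk length \<open>r\<close> gives degree
  \<open>(6 * n) ^ r\<close>, so \<open>r\<close> may be at most about n^(1 - \<delta>) / log n. The
  Fourier bound holds in every Banach space, but without orthogonality in X it costs a factor
  \<open>2 ^ n\<close> and gives contraction only at lengths of order n. It yields finiteness of the
  Poincare constant; the uniform constant requires saving a power of n, and this is what K-convexity
  provides. The saved exponent \<beta> and the constant C in front depend on X, while the graphs and
  thresholds must not. Hence \<open>large\<close> constrains n in terms of \<delta> only, and X
  enters by taking \<delta> small: if \<delta> \<le> 1 / (4 C), then n^\<delta> \<ge> 1 / \<delta>
  absorbs C. The walk is lazy because the average of the identity and a translation is idempotent. A
  product of such averages depends only on the set of its indices, so a further average over indices
  already present changes nothing. This is what lets a contraction single out some of the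
  differences and kill the others.\<close>

lemma (in banach_on) norm_0: "p 0 = 0"
  using norm_eq_0[OF subspace_0[OF subspace]] by simp

lemma (in banach_on) norm_minus_commute: "x \<in> S \<Longrightarrow> y \<in> S \<Longrightarrow> p (x - y) = p (y - x)"
  using norm_scale[of "x - y" "-1"] subspace_diff[OF subspace] by simp

lemma (in banach_on) norm_diff_triangle:
  "x \<in> S \<Longrightarrow> y \<in> S \<Longrightarrow> z \<in> S \<Longrightarrow> p (x - z) \<le> p (x - y) + p (y - z)"
  using norm_triangle[of "x - y" "y - z"] subspace_diff[OF subspace] by simp

text \<open>The involution and commutation laws are required at all indices and all points of the
  type, so that the operators below satisfy their identities as functions on the whole type. Only
  norms and sums refer to \<open>V\<close>.\<close>

locale involutions =
  fixes V :: "'a set" and \<tau> :: "nat \<Rightarrow> 'a \<Rightarrow> 'a" and N :: nat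
  assumes fin: "finite V" and N_pos: "0 < N"
    and invol: "\<tau> j (\<tau> j x) = x" and comm: "\<tau> i (\<tau> j x) = \<tau> j (\<tau> i x)"
    and closed: "x \<in> V \<Longrightarrow> \<tau> j x \<in> V"

locale walk = banach_on S p + involutions V \<tau> N
  for S :: "'v::real_vector set" and p and V :: "'a set" and \<tau> N
begin

definition nrm :: "('a \<Rightarrow> 'v) \<Rightarrow> real" where
  "nrm f = L2_set (\<lambda>x. p (f x)) V"

lemmas S_add = subspace_add[OF subspace] and S_diff = subspace_diff[OF subspace]
  and S_scale = subspace_scale[OF subspace]
  and S_sum = subspace_sum[OF subspace]

lemma p_minus: "x \<in> S \<Longrightarrow> p (- x) = p x"
  using norm_scale[of x "-1"] by simp

lemma p_diff: "x \<in> S \<Longrightarrow> y \<in> S \<Longrightarrow> p (x - y) \<le> p x + p y"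
  using norm_triangle[of x "- y"] p_minus[of y] subspace_neg[OF subspace, of y] by simp

lemma p_sum:
  assumes "finite A" "\<And>a. a \<in> A \<Longrightarrow> f a \<in> S"
  shows "p (\<Sum>a\<in>A. f a) \<le> (\<Sum>a\<in>A. p (f a))"
  using assms
proof (induction A rule: finite_induct)
  case (insert a A)
  have "p (f a + (\<Sum>a\<in>A. f a)) \<le> p (f a) + p (\<Sum>a\<in>A. f a)"
    by (intro norm_triangle S_sum) (use insert in auto)
  with insert show ?case by fastforce
qed (simp add: norm_0)

lemma nrm_nonneg: "0 \<le> nrm f"
  by (simp add: nrm_def)

lemma nrm_sq: "(nrm f)\<^sup>2 = (\<Sum>x\<in>V. (p (f x))\<^sup>2)"
  by (simp add: nrm_def L2_set_def sum_nonneg)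

lemma nrm_0: "nrm (\<lambda>x. 0) = 0"
  by (simp add: nrm_def norm_0 L2_set_def)

lemma nrm_add:
  assumes "f \<in> V \<rightarrow> S" "g \<in> V \<rightarrow> S"
  shows "nrm (\<lambda>x. f x + g x) \<le> nrm f + nrm g"
proof -
  have "nrm (\<lambda>x. f x + g x) \<le> L2_set (\<lambda>x. p (f x) + p (g x)) V"
    unfolding nrm_def
    by (rule L2_set_mono) (use assms in \<open>auto intro!: norm_triangle norm_nonneg S_add\<close>)
  also have "\<dots> \<le> nrm f + nrm g"
    unfolding nrm_def by (rule L2_set_triangle_ineq)
  finally show ?thesis .
qed

lemma nrm_scale:
  assumes "f \<in> V \<rightarrow> S"
  shows "nrm (\<lambda>x. c *\<^sub>R f x) = \<bar>c\<bar> * nrm f"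
proof -
  have "nrm (\<lambda>x. c *\<^sub>R f x) = L2_set (\<lambda>x. \<bar>c\<bar> * p (f x)) V"
    unfolding nrm_def by (rule L2_set_cong) (use assms in \<open>auto intro!: norm_scale\<close>)
  then show ?thesis
    unfolding nrm_def by (simp add: L2_set_right_distrib)
qed

lemma nrm_diff:
  assumes "f \<in> V \<rightarrow> S" "g \<in> V \<rightarrow> S"
  shows "nrm (\<lambda>x. f x - g x) \<le> nrm f + nrm g"
  using nrm_add[of f "\<lambda>x. (-1) *\<^sub>R g x"] nrm_scale[of g "-1"] assms
  by (auto simp: Pi_def intro!: subspace_neg[OF subspace])

lemma nrm_sum:
  assumes "finite A" "\<And>a. a \<in> A \<Longrightarrow> F a \<in> V \<rightarrow> S"
  shows "nrm (\<lambda>x. \<Sum>a\<in>A. F a x) \<le> (\<Sum>a\<in>A. nrm (F a))"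
  using assms
proof (induction A rule: finite_induct)
  case (insert a A)
  have "nrm (\<lambda>x. F a x + (\<Sum>a\<in>A. F a x)) \<le> nrm (F a) + nrm (\<lambda>x. \<Sum>a\<in>A. F a x)"
    using insert.prems by (intro nrm_add) (fastforce intro!: S_sum)+
  with insert show ?case by fastforce
qed (simp add: nrm_0)

definition lin :: "(('a \<Rightarrow> 'v) \<Rightarrow> ('a \<Rightarrow> 'v)) \<Rightarrow> bool" where
  "lin T \<longleftrightarrow> (\<forall>f g. T (\<lambda>x. f x + g x) = (\<lambda>x. T f x + T g x)) \<and>
     (\<forall>c f. T (\<lambda>x. c *\<^sub>R f x) = (\<lambda>x. c *\<^sub>R T f x))"

definition contraction :: "(('a \<Rightarrow> 'v) \<Rightarrow> ('a \<Rightarrow> 'v)) \<Rightarrow> bool" where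
  "contraction T \<longleftrightarrow> (\<forall>f\<in>V \<rightarrow> S. T f \<in> V \<rightarrow> S \<and> nrm (T f) \<le> nrm f)"

lemma lin_add: "lin T \<Longrightarrow> T (\<lambda>x. f x + g x) = (\<lambda>x. T f x + T g x)"
  and lin_scale: "lin T \<Longrightarrow> T (\<lambda>x. c *\<^sub>R f x) = (\<lambda>x. c *\<^sub>R T f x)"
  by (simp_all add: lin_def)

lemma lin_zero: "lin T \<Longrightarrow> T (\<lambda>x. 0) = (\<lambda>x. 0)"
  using lin_scale[of T 0 "\<lambda>x. 0"] by simp

lemma lin_diff: "lin T \<Longrightarrow> T (\<lambda>x. f x - g x) = (\<lambda>x. T f x - T g x)"
  using lin_add[of T f "\<lambda>x. (-1) *\<^sub>R g x"] lin_scale[of T "-1" g] by simp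

lemma lin_sum: "lin T \<Longrightarrow> T (\<lambda>x. \<Sum>a\<in>A. F a x) = (\<lambda>x. \<Sum>a\<in>A. T (F a) x)"
  by (induction A rule: infinite_finite_induct)
    (simp_all add: lin_zero lin_add[where g = "\<lambda>x. \<Sum>a\<in>_. F a x"])

lemma lin_comp: "lin T \<Longrightarrow> lin U \<Longrightarrow> lin (\<lambda>f. T (U f))"
  by (simp add: lin_def)

lemma lin_funpow: "lin T \<Longrightarrow> lin (T ^^ k)"
  by (induction k) (simp_all add: lin_def)

lemma contraction_mem: "contraction T \<Longrightarrow> f \<in> V \<rightarrow> S \<Longrightarrow> T f \<in> V \<rightarrow> S"
  and contraction_le: "contraction T \<Longrightarrow> f \<in> V \<rightarrow> S \<Longrightarrow> nrm (T f) \<le> nrm f"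
  by (simp_all add: contraction_def)

lemma contraction_comp:
  "contraction T \<Longrightarrow> contraction U \<Longrightarrow> contraction (\<lambda>f. T (U f))"
  unfolding contraction_def by (meson order_trans)

lemma contraction_funpow: "contraction T \<Longrightarrow> contraction (T ^^ k)"
proof (induction k)
  case (Suc k)
  then show ?case
    using contraction_comp[of T "T ^^ k"] by (simp add: comp_def)
qed (simp add: contraction_def)

text \<open>The conditional expectation onto the functions invariant under
  \<open>\<tau> j\<close>.\<close>

definition E :: "nat \<Rightarrow> ('a \<Rightarrow> 'v) \<Rightarrow> ('a \<Rightarrow> 'v)" where
  "E j f = (\<lambda>x. (1/2) *\<^sub>R (f x + f (\<tau> j x)))"

text \<open>A fold over a set makes sense because the \<open>E j\<close> commute and are idempotent:
  repeated indices count once. For infinite \<open>J\<close> the fold is the identity.\<close>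

definition EE :: "nat set \<Rightarrow> ('a \<Rightarrow> 'v) \<Rightarrow> ('a \<Rightarrow> 'v)" where
  "EE J f = Finite_Set.fold E f J"

definition Q :: "('a \<Rightarrow> 'v) \<Rightarrow> ('a \<Rightarrow> 'v)" where
  "Q f = (\<lambda>x. (1 / real N) *\<^sub>R (\<Sum>j<N. E j f x))"

sublocale E: comp_fun_idem E
proof
  show "E y \<circ> E x = E x \<circ> E y" for x y
    by (rule ext)+ (simp add: E_def comm[of x y] algebra_simps)
  have "(1/2) *\<^sub>R ((1/2) *\<^sub>R (a + b) + (1/2) *\<^sub>R (b + a)) = (1/2) *\<^sub>R (a + b)" for a b :: 'v
    by (simp add: add.commute[of b a] flip: scaleR_2[of "(1/2) *\<^sub>R (a + b)"])
  then show "E x \<circ> E x = E x" for x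
    by (intro ext) (simp add: E_def invol)
qed

lemma EE_empty: "EE {} f = f"
  by (simp add: EE_def)

lemma EE_insert: "finite J \<Longrightarrow> EE (insert j J) f = E j (EE J f)"
  by (simp add: EE_def E.fold_insert_idem)

lemma EE_Un: "finite J \<Longrightarrow> finite J' \<Longrightarrow> EE (J \<union> J') f = EE J (EE J' f)"
  by (induction J rule: finite_induct) (simp_all add: EE_empty EE_insert)

lemma lin_E: "lin (E j)"
  by (simp add: lin_def E_def algebra_simps fun_eq_iff)

lemma lin_EE: "lin (EE J)"
proof (cases "finite J")
  case True
  then show ?thesis
  proof (induction J rule: finite_induct)
    case (insert j J)
    have "EE (insert j J) = (\<lambda>f. E j (EE J f))"
      using insert by (auto simp: EE_insert)
    with insert lin_comp[OF lin_E] show ?case by simp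
  qed (simp add: EE_empty lin_def)
qed (simp add: EE_def lin_def)

lemma tau_bij: "bij_betw (\<tau> j) V V"
  by (rule bij_betwI[of _ _ _ "\<tau> j"]) (auto simp: invol closed)

lemma contraction_E: "contraction (E j)"
  unfolding contraction_def
proof safe
  fix f assume f: "f \<in> V \<rightarrow> S"
  show m: "E j f x \<in> S" if "x \<in> V" for x
    using f that by (auto simp: E_def closed intro!: S_scale S_add)
  have ft: "(\<lambda>x. f (\<tau> j x)) \<in> V \<rightarrow> S"
    using f closed by auto
  have "nrm (\<lambda>x. f (\<tau> j x)) = nrm f"
    unfolding nrm_def L2_set_def
    by (subst sum.reindex_bij_betw[OF tau_bij, of "\<lambda>x. (p (f x))\<^sup>2"]) simp
  then have "nrm (\<lambda>x. f x + f (\<tau> j x)) \<le> 2 * nrm f"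
    using nrm_add[OF f ft] by simp
  moreover have "nrm (E j f) = 1/2 * nrm (\<lambda>x. f x + f (\<tau> j x))"
    unfolding E_def by (subst nrm_scale) (use f ft in \<open>auto intro!: S_add\<close>)
  ultimately show "nrm (E j f) \<le> nrm f"
    by simp
qed

lemma contraction_EE: "contraction (EE J)"
proof (cases "finite J")
  case True
  then show ?thesis
  proof (induction J rule: finite_induct)
    case (insert j J)
    have "EE (insert j J) = (\<lambda>f. E j (EE J f))"
      using insert by (auto simp: EE_insert)
    with insert contraction_comp[OF contraction_E] show ?case by simp
  qed (simp add: EE_empty contraction_def)
qed (simp add: EE_def contraction_def)

lemma lin_Q: "lin Q"
  by (simp add: lin_def Q_def fun_eq_iff lin_add[OF lin_E] lin_scale[OF lin_E] sum.distrib
      scaleR_sum_right scaleR_add_right mult.commute)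

lemma contraction_Q: "contraction Q"
  unfolding contraction_def
proof safe
  fix f assume f: "f \<in> V \<rightarrow> S"
  have E: "E j f \<in> V \<rightarrow> S" for j
    using contraction_mem[OF contraction_E f] .
  show "Q f x \<in> S" if "x \<in> V" for x
    using E that by (auto simp: Q_def intro!: S_scale S_sum)
  have "nrm (Q f) = 1 / real N * nrm (\<lambda>x. \<Sum>j<N. E j f x)"
    unfolding Q_def using E by (subst nrm_scale) (auto intro!: S_sum)
  also have "nrm (\<lambda>x. \<Sum>j<N. E j f x) \<le> (\<Sum>j<N. nrm (E j f))"
    using E by (intro nrm_sum) auto
  also have "\<dots> \<le> (\<Sum>j<N. nrm f)"
    by (intro sum_mono contraction_le[OF contraction_E f])
  finally show "nrm (Q f) \<le> nrm f"
    using N_pos by (simp add: divide_right_mono)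
qed

text \<open>Expanding the power of \<open>Q\<close> gives an average over words of length
  \<open>card U\<close>; a repeated letter is harmless by idempotence. The words are indexed by the
  larger set \<open>W\<close>, with the letters outside \<open>U\<close> summed freely, so that
  averages for different \<open>U\<close> can be compared over the same words.\<close>

lemma avg_EE:
  assumes "finite W" "U \<subseteq> W"
  shows "(\<Sum>A\<in>W \<rightarrow>\<^sub>E {..<N}. EE (A ` U) f x) = real N ^ card W *\<^sub>R (Q ^^ card U) f x"
  using assms
proof (induction W arbitrary: U x rule: finite_induct)
  case empty
  then show ?case by (simp add: EE_empty)
next
  case (insert w W)
  have inj: "inj_on (\<lambda>(j, A). A(w := j)) ({..<N} \<times> (W \<rightarrow>\<^sub>E {..<N}))"
    using insert.hyps by (intro inj_combinator) auto
  have split: "(\<Sum>A\<in>insert w W \<rightarrow>\<^sub>E {..<N}. EE (A ` U) f x) =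
      (\<Sum>j<N. \<Sum>A\<in>W \<rightarrow>\<^sub>E {..<N}. EE (A(w := j) ` U) f x)"
    unfolding PiE_insert_eq
    by (subst sum.reindex[OF inj]) (simp add: sum.cartesian_product case_prod_unfold)
  show ?case
  proof (cases "w \<in> U")
    case True
    define U' where "U' = U - {w}"
    have U: "U = insert w U'" "w \<notin> U'" "U' \<subseteq> W" "finite U'"
      using True insert.prems insert.hyps finite_subset by (auto simp: U'_def)
    have "EE (A(w := j) ` U) f = E j (EE (A ` U') f)" for A j
    proof -
      have "A(w := j) ` U = insert j (A ` U')"
        using U by auto
      then show ?thesis
        using U by (simp add: EE_insert)
    qed
    then have "(\<Sum>A\<in>insert w W \<rightarrow>\<^sub>E {..<N}. EE (A ` U) f x) =
        (\<Sum>j<N. \<Sum>A\<in>W \<rightarrow>\<^sub>E {..<N}. E j (EE (A ` U') f) x)"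
      by (simp add: split)
    also have "\<dots> = (\<Sum>j<N. E j (\<lambda>x. \<Sum>A\<in>W \<rightarrow>\<^sub>E {..<N}. EE (A ` U') f x) x)"
      by (simp add: lin_sum[OF lin_E])
    also have "\<dots> = (\<Sum>j<N. real N ^ card W *\<^sub>R E j ((Q ^^ card U') f) x)"
      by (simp add: insert.IH[OF U(3)] lin_scale[OF lin_E])
    also have "\<dots> = real N ^ card (insert w W) *\<^sub>R (Q ^^ card U) f x"
      using U insert.hyps N_pos by (simp add: Q_def scaleR_sum_right)
    finally show ?thesis .
  next
    case False
    then have "U \<subseteq> W" using insert.prems by auto
    have eq: "A(w := j) ` U = A ` U" for A j
      using False by auto
    show ?thesis
      unfolding split eq using insert.hyps by (simp add: insert.IH[OF \<open>U \<subseteq> W\<close>] scaleR_sum_right sum_constant_scaleR)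
  qed
qed

end

section \<open>K-convexity and differences of averages\<close>

lemma finite_cube [simp]: "finite (cube m)"
  by (simp add: cube_def finite_PiE)

lemma card_cube [simp]: "card (cube m) = 2 ^ m"
  by (simp add: cube_def card_PiE numeral_2_eq_2)

lemma sum_cube_Suc:
  "(\<Sum>e\<in>cube (Suc m). F e) = (\<Sum>e\<in>cube m. F (e(m := 0)) + F (e(m := 1)))"
proof -
  have inj: "inj_on (\<lambda>(j, A). A(m := j)) ({0, 1::nat} \<times> ({..<m} \<rightarrow>\<^sub>E {0, 1}))"
    by (intro inj_combinator) auto
  show ?thesis
    unfolding cube_def lessThan_Suc PiE_insert_eq
    by (subst sum.reindex[OF inj])
      (simp add: sum.cartesian_product' sum.distrib)
qed

text \<open>\<open>2 ^ m\<close> times the expectation of \<open>\<phi>\<close> at a sum of m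
  independent random signs. Since the recursion shifts \<open>\<phi>\<close>, the moments below are
  stated with a free shift \<open>a\<close>.\<close>

primrec signsum :: "nat \<Rightarrow> (real \<Rightarrow> real) \<Rightarrow> real" where
  "signsum 0 \<phi> = \<phi> 0"
| "signsum (Suc m) \<phi> = signsum m (\<lambda>t. \<phi> (t + 1)) + signsum m (\<lambda>t. \<phi> (t - 1))"

text \<open>Multiplying the signs of \<open>e\<close> by those of \<open>w\<close> permutes the
  cube. Hence the sum does not depend on \<open>w\<close>, which later makes the coefficients of all
  differences equal.\<close>

lemma sum_cube_sign:
  assumes "\<And>i. i < m \<Longrightarrow> w i \<in> {0, 1}"
  shows "(\<Sum>e\<in>cube m. \<phi> (\<Sum>i<m. walsh i e * walsh i w)) = signsum m \<phi>"
  using assms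
proof (induction m arbitrary: \<phi>)
  case 0
  then show ?case by (simp add: cube_def)
next
  case (Suc m)
  have upd: "(\<Sum>i<m. walsh i (e(m := b)) * walsh i w) = (\<Sum>i<m. walsh i e * walsh i w)" for e b
    by (rule sum.cong) (auto simp: walsh_def)
  have "w m = 0 \<or> w m = 1" using Suc.prems[of m] by auto
  moreover have "(\<Sum>e\<in>cube m. \<phi> ((\<Sum>i<m. walsh i e * walsh i w) + c)) = signsum m (\<lambda>t. \<phi> (t + c))" for c
    by (rule Suc.IH[of "\<lambda>t. \<phi> (t + c)"]) (use Suc.prems in auto)
  note this[of 1] this[of "-1"]
  ultimately show ?case
    by (auto simp: sum_cube_Suc upd walsh_def sum.distrib)
qed

lemma signsum_mono: "(\<And>t. \<phi> t \<le> \<psi> t) \<Longrightarrow> signsum m \<phi> \<le> signsum m \<psi>"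
  by (induction m arbitrary: \<phi> \<psi>) (auto intro!: add_mono)

lemma signsum_lin: "signsum m (\<lambda>t. c * \<phi> t + d * \<psi> t) = c * signsum m \<phi> + d * signsum m \<psi>"
  by (induction m arbitrary: \<phi> \<psi>) (auto simp: algebra_simps)

lemma signsum_1: "signsum m (\<lambda>t. t + a) = 2 ^ m * a"
proof (induction m arbitrary: a)
  case (Suc m)
  then show ?case
    using Suc[of "1 + a"] Suc[of "a - 1"] by (simp add: algebra_simps)
qed simp

lemma signsum_2: "signsum m (\<lambda>t. (t + a)\<^sup>2) = 2 ^ m * (real m + a\<^sup>2)"
proof (induction m arbitrary: a)
  case (Suc m)
  have eq: "t + 1 + a = t + (a + 1)" "t - 1 + a = t + (a - 1)" for t by simp_all
  show ?case
    unfolding signsum.simps eq Suc by (simp add: algebra_simps power2_eq_square)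
qed simp

lemma signsum_4:
  "signsum m (\<lambda>t. (t + a) ^ 4) = 2 ^ m * (a ^ 4 + 6 * a\<^sup>2 * real m + 3 * (real m)\<^sup>2 - 2 * real m)"
proof (induction m arbitrary: a)
  case (Suc m)
  have eq: "t + 1 + a = t + (a + 1)" "t - 1 + a = t + (a - 1)" for t by simp_all
  show ?case
    unfolding signsum.simps eq Suc by (simp add: algebra_simps power2_eq_square power4_eq_xxxx)
qed simp

text \<open>Khinchine's inequality by the fourth moment method: \<open>2 a\<^sup>3 \<bar>t\<bar> \<ge> 3 a\<^sup>2 t\<^sup>2 - t\<^sup>4\<close>.\<close>

lemma signsum_pos_part:
  assumes "0 < k"
  shows "2 ^ (3 * k\<^sup>2) * real k / 2 \<le> signsum (3 * k\<^sup>2) (\<lambda>t. max t 0)"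
proof -
  define m where "m = 3 * k\<^sup>2"
  \<comment> \<open>This is the square root of 3 m, where 3 m / a - 3 m^2 / a^3 is maximal; m = 3
    k^2 makes it an integer. The two terms become 3 k and k.\<close>
  define a where "a = 3 * real k"
  have a: "a > 0" using assms by (simp add: a_def)
  \<comment> \<open>The positive part is t/2 + \<bar>t\<bar>/2. The second half is estimated by the
    fourth moment inequality, which comes from the factorization \<bar>t\<bar> (\<bar>t\<bar> - a)^2
    (\<bar>t\<bar> + 2 a) \<ge> 0.\<close>
  have pt: "(1/2) * t + (1/4) * ((3 / a) * t\<^sup>2 + (- 1 / a ^ 3) * t ^ 4) \<le> max t 0" for t
  proof -
    have "0 \<le> \<bar>t\<bar> * (\<bar>t\<bar> - a)\<^sup>2 * (\<bar>t\<bar> + 2 * a)"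
      using a by simp
    also have "\<dots> = 2 * a ^ 3 * \<bar>t\<bar> - 3 * a\<^sup>2 * \<bar>t\<bar>\<^sup>2 + \<bar>t\<bar> ^ 4"
      by (simp add: algebra_simps power2_eq_square power3_eq_cube power4_eq_xxxx del: abs_mult_self_eq)
    finally have "3 * a\<^sup>2 * t\<^sup>2 - t ^ 4 \<le> a ^ 3 * (2 * \<bar>t\<bar>)"
      by (simp add: algebra_simps)
    then have "(3 * a\<^sup>2 * t\<^sup>2 - t ^ 4) / a ^ 3 \<le> 2 * \<bar>t\<bar>"
      using a by (simp add: divide_le_eq mult.commute)
    moreover have "(3 * a\<^sup>2 * t\<^sup>2 - t ^ 4) / a ^ 3 = (3 / a) * t\<^sup>2 + (- 1 / a ^ 3) * t ^ 4"
      using a by (simp add: field_simps power2_eq_square power3_eq_cube)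
    ultimately have "(3 / a) * t\<^sup>2 + (- 1 / a ^ 3) * t ^ 4 \<le> 2 * \<bar>t\<bar>"
      by metis
    moreover have "(1/2) * t + (1/4) * z \<le> max t 0" if "z \<le> 2 * \<bar>t\<bar>" for z
      using that by linarith
    ultimately show ?thesis by blast
  qed
  have "signsum m (\<lambda>t. (1/2) * t + (1/4) * ((3 / a) * t\<^sup>2 + (- 1 / a ^ 3) * t ^ 4)) =
      2 ^ m / 4 * (3 / a * real m - (3 * (real m)\<^sup>2 - 2 * real m) / a ^ 3)"
  proof -
    have "signsum m (\<lambda>t. t) = 0" "signsum m (\<lambda>t. t\<^sup>2) = 2 ^ m * real m"
      "signsum m (\<lambda>t. t ^ 4) = 2 ^ m * (3 * (real m)\<^sup>2 - 2 * real m)"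
      using signsum_1[of m 0] signsum_2[of m 0] signsum_4[of m 0] by simp_all
    note moments = this
    show ?thesis
      unfolding signsum_lin moments using a by (simp add: field_simps)
  qed
  also have "\<dots> \<ge> 2 ^ m / 4 * (3 / a * real m - (3 * (real m)\<^sup>2) / a ^ 3)"
    using a by (intro mult_left_mono diff_left_mono divide_right_mono) auto
  also have "3 / a * real m = 3 * real k"
    using assms by (simp add: a_def m_def field_simps power2_eq_square)
  also have "(3 * (real m)\<^sup>2) / a ^ 3 = real k"
    using assms by (simp add: a_def m_def field_simps power2_eq_square power3_eq_cube)
  finally have "2 ^ m * real k / 2 \<le> signsum m (\<lambda>t. (1/2) * t + (1/4) * ((3 / a) * t\<^sup>2 + (- 1 / a ^ 3) * t ^ 4))"
    by (simp add: mult.commute)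
  also have "\<dots> \<le> signsum m (\<lambda>t. max t 0)"
    by (rule signsum_mono) (rule pt)
  finally show ?thesis by (simp add: m_def)
qed

text \<open>The bound K for the norm of the Rademacher projection, squared, with the factor
  \<open>1 / 2 ^ m\<close> cancelled on both sides.\<close>

locale K_walk = walk S p V \<tau> N for S :: "'v::real_vector set" and p and V :: "'a set" and \<tau> N +
  fixes K :: real
  assumes K_nonneg: "0 \<le> K"
    and K_bound: "1 \<le> m \<Longrightarrow> F \<in> cube m \<rightarrow> S \<Longrightarrow>
      (\<Sum>e\<in>cube m. (p (Rad m F e))\<^sup>2) \<le> K\<^sup>2 * (\<Sum>e\<in>cube m. (p (F e))\<^sup>2)"
begin

text \<open>The hypercube function \<open>w \<mapsto> h w\<close> has a Rademacher projection whose value at \<open>e\<close> is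
  \<open>\<Sum>w. \<langle>e, w\<rangle> h w\<close> up to scaling. The contraction \<open>EE (\<Union>w\<in>U. J w)\<close> kills \<open>h w\<close> for \<open>w \<in> U\<close> and fixes the
  other \<open>h w\<close>, so that only the terms with \<open>\<langle>e, w\<rangle> > 0\<close> can be kept. Averaging over \<open>e\<close> then gives
  equal coefficients of order \<open>\<surd>m\<close>.\<close>

lemma level_one_bound:
  assumes m: "1 \<le> m" and J: "\<And>w. finite (J w)" and f: "f \<in> V \<rightarrow> S"
  defines "h \<equiv> \<lambda>w x. EE (\<Union>v\<in>cube m - {w}. J v) f x - EE (\<Union>v\<in>cube m. J v) f x"
  shows "signsum m (\<lambda>t. max t 0) * nrm (\<lambda>x. \<Sum>w\<in>cube m. h w x) \<le> 2 * K * 4 ^ m * nrm f"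
proof -
  define D where "D e w = (\<Sum>i<m. walsh i e * walsh i w)" for e w :: "nat \<Rightarrow> nat"
  define G where "G e = (\<lambda>x. \<Sum>w\<in>cube m. D e w *\<^sub>R h w x)" for e
  define U where "U e = {w\<in>cube m. D e w \<le> 0}" for e
  have EEm: "EE I f' \<in> V \<rightarrow> S" if "f' \<in> V \<rightarrow> S" for I f'
    using contraction_mem[OF contraction_EE that] .
  have hm: "h w \<in> V \<rightarrow> S" for w
    using EEm[OF f] by (auto simp: h_def intro!: S_diff)
  have hn: "nrm (h w) \<le> 2 * nrm f" for w
  proof -
    have "nrm (h w) \<le> nrm (EE (\<Union>v\<in>cube m - {w}. J v) f) + nrm (EE (\<Union>v\<in>cube m. J v) f)"
      unfolding h_def by (rule nrm_diff) (rule EEm[OF f])+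
    then show ?thesis
      using contraction_le[OF contraction_EE f] by (smt (verit))
  qed
  have Gm: "G e \<in> V \<rightarrow> S" for e
    using hm by (auto simp: G_def intro!: S_sum S_scale)
  have rad: "G e x = 2 ^ m *\<^sub>R Rad m (\<lambda>w. h w x) e" for e x
  proof -
    have "2 ^ m *\<^sub>R Rad m (\<lambda>w. h w x) e = (\<Sum>i<m. \<Sum>w\<in>cube m. (walsh i e * walsh i w) *\<^sub>R h w x)"
      by (simp add: Rad_def fourier_def scaleR_sum_right)
    also have "\<dots> = G e x"
      unfolding G_def D_def by (subst sum.swap) (simp add: scaleR_sum_left)
    finally show ?thesis ..
  qed
  have radS: "Rad m (\<lambda>w. h w x) e \<in> S" if "x \<in> V" for x e
    unfolding Rad_def fourier_def using hm that by (intro S_sum S_scale) auto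
  \<comment> \<open>Exchanging the sums allows K-convexity of X to be applied at each point
    \<open>x\<close> separately.\<close>
  have "(\<Sum>e\<in>cube m. (nrm (G e))\<^sup>2) = (\<Sum>x\<in>V. \<Sum>e\<in>cube m. (p (G e x))\<^sup>2)"
    unfolding nrm_sq by (rule sum.swap)
  also have "\<dots> = (\<Sum>x\<in>V. 4 ^ m * (\<Sum>e\<in>cube m. (p (Rad m (\<lambda>w. h w x) e))\<^sup>2))"
    by (intro sum.cong refl)
      (simp add: rad norm_scale radS power_mult_distrib sum_distrib_left flip: power_mult,
        simp add: power_mult mult.commute[of m])
  also have "\<dots> \<le> (\<Sum>x\<in>V. 4 ^ m * (K\<^sup>2 * (\<Sum>w\<in>cube m. (p (h w x))\<^sup>2)))"
    using hm by (intro sum_mono mult_left_mono K_bound m) auto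
  also have "\<dots> = 4 ^ m * K\<^sup>2 * (\<Sum>w\<in>cube m. (nrm (h w))\<^sup>2)"
    unfolding nrm_sq sum.swap[of _ V "cube m"] by (simp add: sum_distrib_left mult.assoc)
  also have "\<dots> \<le> 4 ^ m * K\<^sup>2 * (\<Sum>w\<in>cube m. (2 * nrm f)\<^sup>2)"
    by (intro mult_left_mono sum_mono power_mono hn nrm_nonneg) auto
  finally have sq: "(\<Sum>e\<in>cube m. (nrm (G e))\<^sup>2) \<le> 4 ^ m * K\<^sup>2 * (2 ^ m * (2 * nrm f)\<^sup>2)"
    by simp
  \<comment> \<open>Cauchy-Schwarz over the \<open>2 ^ m\<close> points of the cube.\<close>
  have "(\<Sum>e\<in>cube m. nrm (G e))\<^sup>2 \<le> (\<Sum>e\<in>cube m. (nrm (G e))\<^sup>2) * 2 ^ m"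
    using sum_squared_le_sum_of_squares[of "\<lambda>e. nrm (G e)" "cube m"] by simp
  also have "\<dots> \<le> 4 ^ m * K\<^sup>2 * (2 ^ m * (2 * nrm f)\<^sup>2) * 2 ^ m"
    using sq by (rule mult_right_mono) simp
  also have "\<dots> = (2 * K * 4 ^ m * nrm f)\<^sup>2"
  proof -
    have "(4::real) ^ m = 2 ^ m * 2 ^ m"
      by (simp flip: power_mult_distrib)
    then show ?thesis by (simp add: power2_eq_square)
  qed
  finally have cs: "(\<Sum>e\<in>cube m. nrm (G e)) \<le> 2 * K * 4 ^ m * nrm f"
    by (rule power2_le_imp_le) (simp add: K_nonneg nrm_nonneg)
  have fin': "finite (\<Union>v\<in>A. J v)" if "A \<subseteq> cube m" for A
    using J finite_subset[OF that] by auto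
  \<comment> \<open>Composition takes the union of the index sets. If \<open>w\<close> is in
    \<open>U e\<close>, both terms of \<open>h w\<close> become the average over all blocks and
    cancel; otherwise both unions stay as they were.\<close>
  have kill: "EE (\<Union>v\<in>U e. J v) (h w) = (if D e w \<le> 0 then (\<lambda>x. 0) else h w)"
    if w: "w \<in> cube m" for e w
  proof -
    have Us: "U e \<subseteq> cube m" by (auto simp: U_def)
    have "EE (\<Union>v\<in>U e. J v) (h w) =
      (\<lambda>x. EE ((\<Union>v\<in>U e. J v) \<union> (\<Union>v\<in>cube m - {w}. J v)) f x -
           EE ((\<Union>v\<in>U e. J v) \<union> (\<Union>v\<in>cube m. J v)) f x)"
      unfolding h_def lin_diff[OF lin_EE]
      by (subst (1 2) EE_Un) (use J Us in \<open>auto intro!: fin'\<close>)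
    moreover have "(\<Union>v\<in>U e. J v) \<union> (\<Union>v\<in>cube m. J v) = (\<Union>v\<in>cube m. J v)"
      using Us by auto
    moreover have "(\<Union>v\<in>U e. J v) \<union> (\<Union>v\<in>cube m - {w}. J v) =
        (if D e w \<le> 0 then (\<Union>v\<in>cube m. J v) else (\<Union>v\<in>cube m - {w}. J v))"
      using w by (auto simp: U_def)
    ultimately show ?thesis by (auto simp: h_def)
  qed
  have proj: "EE (\<Union>v\<in>U e. J v) (G e) = (\<lambda>x. \<Sum>w\<in>cube m. max (D e w) 0 *\<^sub>R h w x)" for e
    unfolding G_def lin_sum[OF lin_EE] lin_scale[OF lin_EE]
    by (intro ext sum.cong refl) (simp add: kill max_def)
  have "(\<Sum>e\<in>cube m. EE (\<Union>v\<in>U e. J v) (G e) x) =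
      signsum m (\<lambda>t. max t 0) *\<^sub>R (\<Sum>w\<in>cube m. h w x)" for x
  proof -
    have "(\<Sum>e\<in>cube m. EE (\<Union>v\<in>U e. J v) (G e) x) =
        (\<Sum>w\<in>cube m. (\<Sum>e\<in>cube m. max (D e w) 0) *\<^sub>R h w x)"
      unfolding proj by (subst sum.swap) (simp add: scaleR_sum_left)
    also have "\<dots> = (\<Sum>w\<in>cube m. signsum m (\<lambda>t. max t 0) *\<^sub>R h w x)"
    proof (intro sum.cong refl)
      fix w assume w: "w \<in> cube m"
      have "(\<Sum>e\<in>cube m. max (D e w) 0) = signsum m (\<lambda>t. max t 0)"
        unfolding D_def using w
        by (intro sum_cube_sign[where \<phi> = "\<lambda>t. max t 0"]) (auto simp: cube_def PiE_iff)
      then show "(\<Sum>e\<in>cube m. max (D e w) 0) *\<^sub>R h w x = signsum m (\<lambda>t. max t 0) *\<^sub>R h w x"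
        by simp
    qed
    finally show ?thesis by (simp add: scaleR_sum_right)
  qed
  then have "\<bar>signsum m (\<lambda>t. max t 0)\<bar> * nrm (\<lambda>x. \<Sum>w\<in>cube m. h w x) =
      nrm (\<lambda>x. \<Sum>e\<in>cube m. EE (\<Union>v\<in>U e. J v) (G e) x)"
    using hm by (simp, subst nrm_scale) (auto intro!: S_sum)
  also have "\<dots> \<le> (\<Sum>e\<in>cube m. nrm (EE (\<Union>v\<in>U e. J v) (G e)))"
    by (rule nrm_sum) (auto intro: EEm[OF Gm, THEN funcset_mem])
  also have "\<dots> \<le> (\<Sum>e\<in>cube m. nrm (G e))"
    by (intro sum_mono contraction_le[OF contraction_EE Gm])
  finally show ?thesis
    using cs mult_right_mono[OF abs_ge_self nrm_nonneg, of "signsum m (\<lambda>t. max t 0)"]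
    by (smt (verit))
qed

text \<open>Expand both powers of \<open>Q\<close> into averages of \<open>EE\<close> over \<open>2 ^ m\<close> random blocks of length \<open>s\<close>; by
  exchangeability the omitted block may be any of them.\<close>

lemma difference_bound:
  assumes m: "1 \<le> m" and f: "f \<in> V \<rightarrow> S"
  shows "signsum m (\<lambda>t. max t 0) *
      nrm (\<lambda>x. (Q ^^ (s * (2 ^ m - 1))) f x - (Q ^^ (s * 2 ^ m)) f x) \<le> 2 * K * 2 ^ m * nrm f"
proof -
  define R where "R = cube m \<times> {..<s}"
  define \<A> where "\<A> = R \<rightarrow>\<^sub>E {..<N}"
  define c where "c = signsum m (\<lambda>t. max t 0)"
  have R: "finite R" "card R = s * 2 ^ m"
    by (auto simp: R_def card_cartesian_product)
  have \<A>: "finite \<A>" "card \<A> = N ^ (s * 2 ^ m)"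
    using R by (simp_all add: \<A>_def finite_PiE card_PiE)
  have c0: "0 \<le> c"
    unfolding c_def using signsum_mono[of "\<lambda>t. 0" "\<lambda>t. max t 0" m] signsum_lin[of m 0 "\<lambda>t. 0" 0 "\<lambda>t. 0"] by simp
  define J where "J A w = A ` ({w} \<times> {..<s})" for A :: "((nat \<Rightarrow> nat) \<times> nat) \<Rightarrow> nat" and w
  define h where "h A w x = EE (\<Union>v\<in>cube m - {w}. J A v) f x - EE (\<Union>v\<in>cube m. J A v) f x" for A w x
  have hm: "h A w \<in> V \<rightarrow> S" for A w
    by (auto simp: h_def intro!: S_diff funcset_mem[OF contraction_mem[OF contraction_EE f]])
  let ?d = "\<lambda>x. (Q ^^ (s * (2 ^ m - 1))) f x - (Q ^^ (s * 2 ^ m)) f x"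
  have dm: "?d \<in> V \<rightarrow> S"
    using contraction_mem[OF contraction_funpow[OF contraction_Q] f] by (auto intro!: S_diff)
  have one: "(\<Sum>A\<in>\<A>. h A w x) = real N ^ (s * 2 ^ m) *\<^sub>R ?d x" if w: "w \<in> cube m" for w x
  proof -
    have J1: "(\<Union>v\<in>cube m - {w}. J A v) = A ` ((cube m - {w}) \<times> {..<s})" for A
      by (auto simp: J_def)
    have J2: "(\<Union>v\<in>cube m. J A v) = A ` R" for A
      by (auto simp: J_def R_def)
    have card: "card ((cube m - {w}) \<times> {..<s}) = s * (2 ^ m - 1)"
      using w by (simp add: card_cartesian_product)
    have "(cube m - {w}) \<times> {..<s} \<subseteq> R" by (auto simp: R_def)
    from avg_EE[OF R(1) this, of f x] avg_EE[OF R(1) subset_refl, of f x]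
    show ?thesis
      unfolding h_def J1 J2 sum_subtractf \<A>_def card R(2) by (simp add: scaleR_diff_right)
  qed
  \<comment> \<open>All \<open>2 ^ m\<close> omitted blocks have the same average \<open>?d\<close>,
    so the left side gains a factor \<open>2 ^ m\<close>, which turns the \<open>4 ^ m\<close> on
    the right into \<open>2 ^ m\<close>.\<close>
  have "(\<Sum>A\<in>\<A>. \<Sum>w\<in>cube m. h A w x) = (2 ^ m * real N ^ (s * 2 ^ m)) *\<^sub>R ?d x" for x
    by (subst sum.swap) (simp add: one sum_constant_scaleR)
  then have "c * ((2 ^ m * real N ^ (s * 2 ^ m)) * nrm ?d) = c * nrm (\<lambda>x. \<Sum>A\<in>\<A>. \<Sum>w\<in>cube m. h A w x)"
    by (simp only: nrm_scale[OF dm]) simp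
  also have "\<dots> \<le> c * (\<Sum>A\<in>\<A>. nrm (\<lambda>x. \<Sum>w\<in>cube m. h A w x))"
    using hm by (intro mult_left_mono nrm_sum \<A> c0) (fastforce intro!: S_sum)
  also have "\<dots> = (\<Sum>A\<in>\<A>. c * nrm (\<lambda>x. \<Sum>w\<in>cube m. h A w x))"
    by (simp add: sum_distrib_left)
  also have "\<dots> \<le> (\<Sum>A\<in>\<A>. 2 * K * 4 ^ m * nrm f)"
    unfolding c_def h_def using m f by (intro sum_mono level_one_bound) (auto simp: J_def)
  also have "\<dots> = real N ^ (s * 2 ^ m) * (2 * K * (2 ^ m * 2 ^ m) * nrm f)"
    by (simp add: \<A> flip: power_mult_distrib)
  finally have "(2 ^ m * real N ^ (s * 2 ^ m)) * (c * nrm ?d) \<le>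
      (2 ^ m * real N ^ (s * 2 ^ m)) * (2 * K * 2 ^ m * nrm f)"
    by (simp add: mult_ac)
  then show ?thesis
    using N_pos by (subst (asm) mult_le_cancel_left_pos) (simp_all add: c_def)
qed

end

section \<open>Propagation of decay\<close>

context walk
begin

definition mean_zero :: "('a \<Rightarrow> 'v) \<Rightarrow> bool" where
  "mean_zero f \<longleftrightarrow> f \<in> V \<rightarrow> S \<and> (\<Sum>x\<in>V. f x) = 0"

definition decay :: "nat \<Rightarrow> real \<Rightarrow> bool" where
  "decay r \<epsilon> \<longleftrightarrow> (\<forall>f. mean_zero f \<longrightarrow> nrm ((Q ^^ r) f) \<le> \<epsilon> * nrm f)"

lemma decay_mono:
  assumes "decay r \<epsilon>" "r \<le> r'" "\<epsilon> \<le> \<epsilon>'"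
  shows "decay r' \<epsilon>'"
  unfolding decay_def
proof safe
  fix f assume f: "mean_zero f"
  then have fm: "f \<in> V \<rightarrow> S" by (simp add: mean_zero_def)
  have "(Q ^^ r') f = (Q ^^ (r' - r)) ((Q ^^ r) f)"
    using assms(2) by (metis comp_apply funpow_add le_add_diff_inverse2)
  then have "nrm ((Q ^^ r') f) \<le> nrm ((Q ^^ r) f)"
    using contraction_le[OF contraction_funpow[OF contraction_Q]
        contraction_mem[OF contraction_funpow[OF contraction_Q] fm]] by simp
  also have "\<dots> \<le> \<epsilon> * nrm f" using assms(1) f by (simp add: decay_def)
  also have "\<dots> \<le> \<epsilon>' * nrm f" using assms(3) nrm_nonneg by (rule mult_right_mono)
  finally show "nrm ((Q ^^ r') f) \<le> \<epsilon>' * nrm f" .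
qed

lemma sum_Q: "(\<Sum>x\<in>V. Q f x) = (\<Sum>x\<in>V. f x)"
proof -
  have "(\<Sum>x\<in>V. E j f x) = (\<Sum>x\<in>V. f x)" for j
    using sum.reindex_bij_betw[OF tau_bij[of j], of f]
    by (simp add: E_def sum.distrib flip: scaleR_sum_right scaleR_2)
  then have "(\<Sum>j<N. \<Sum>x\<in>V. E j f x) = real N *\<^sub>R (\<Sum>x\<in>V. f x)"
    by (simp add: sum_constant_scaleR)
  then show ?thesis
    using N_pos by (subst (asm) sum.swap) (simp add: Q_def flip: scaleR_sum_right)
qed

lemma Q_cong: "(\<And>x. x \<in> V \<Longrightarrow> f x = g x) \<Longrightarrow> x \<in> V \<Longrightarrow> Q f x = Q g x"
  by (simp add: Q_def E_def closed)

lemma Q_pow_cong: "(\<And>x. x \<in> V \<Longrightarrow> f x = g x) \<Longrightarrow> x \<in> V \<Longrightarrow> (Q ^^ r) f x = (Q ^^ r) g x"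
  by (induction r arbitrary: x) (auto intro: Q_cong)

lemma Q_const: "Q (\<lambda>x. c) = (\<lambda>x. c)"
  using N_pos by (simp add: Q_def E_def sum_constant_scaleR flip: scaleR_2)

lemma Q_pow_const: "(Q ^^ r) (\<lambda>x. c) = (\<lambda>x. c)"
  by (induction r) (simp_all add: Q_const)

lemma funpow_commute:
  assumes "\<And>g. T (D g) = D (T g)"
  shows "(T ^^ a) ((D ^^ b) g) = (D ^^ b) ((T ^^ a) g)"
proof -
  have "T ((D ^^ b) g) = (D ^^ b) (T g)" for g
    by (induction b) (simp_all add: assms)
  then show ?thesis
    by (induction a) simp_all
qed

text \<open>Iterating \<open>g = T g + (g - T g)\<close>, along a lattice path that stops as soon as one of the two
  alternatives has occurred \<open>m\<close> times.\<close>

lemma lattice_path_bound: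
  fixes m
  assumes T: "lin T" "contraction T" and g: "g \<in> V \<rightarrow> S"
  defines "D \<equiv> \<lambda>g x. g x - T g x"
  shows "nrm g \<le> 4 ^ m * max (2 ^ m * nrm ((T ^^ m) g)) (nrm ((D ^^ m) g))"
proof -
  have comm: "(T ^^ a) ((D ^^ b) g) = (D ^^ b) ((T ^^ a) g)" for a b
    by (rule funpow_commute) (simp add: D_def lin_diff[OF T(1)])
  have D_apply: "D g = (\<lambda>x. g x - T g x)" for g
    by (simp add: D_def)
  have Tm: "(T ^^ i) g \<in> V \<rightarrow> S" if "g \<in> V \<rightarrow> S" for i g
    using contraction_mem[OF contraction_funpow[OF T(2)] that] .
  have Dm: "D g \<in> V \<rightarrow> S" if "g \<in> V \<rightarrow> S" for g
    using that contraction_mem[OF T(2) that] by (auto simp: D_def intro!: S_diff)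
  have Dp: "(D ^^ j) g \<in> V \<rightarrow> S" if "g \<in> V \<rightarrow> S" for j g
    by (induction j) (use that in \<open>simp_all add: Dm\<close>)
  have D2: "nrm ((D ^^ j) g) \<le> 2 ^ j * nrm g" if g: "g \<in> V \<rightarrow> S" for j g
  proof (induction j)
    case (Suc j)
    have "nrm (D ((D ^^ j) g)) \<le> nrm ((D ^^ j) g) + nrm (T ((D ^^ j) g))"
      unfolding D_apply[of "(D ^^ j) g"]
      by (rule nrm_diff[OF Dp[OF g] contraction_mem[OF T(2) Dp[OF g]]])
    also have "\<dots> \<le> 2 * nrm ((D ^^ j) g)"
      using contraction_le[OF T(2) Dp[OF g, of j]] by simp
    finally show ?case using Suc by simp
  qed simp
  \<comment> \<open>A boundary point reached after m steps with \<open>T\<close> may carry up to m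
    factors \<open>D\<close>, each of norm at most 2; hence the weight \<open>2 ^ m\<close>.\<close>
  define B where "B = max (2 ^ m * nrm ((T ^^ m) g)) (nrm ((D ^^ m) g))"
  have B0: "0 \<le> B" using nrm_nonneg by (simp add: B_def le_max_iff_disj)
  have up: "b \<le> 2 ^ k * B" if "b \<le> B" for b and k :: nat
    using that B0 mult_right_mono[of 1 "2 ^ k" B] by (simp add: order_trans)
  \<comment> \<open>\<open>k\<close> is the number of steps left to the corner (m, m). Each step
    splits a term in two, so the start contributes \<open>2 ^ (2 * m)\<close>.\<close>
  have "nrm ((T ^^ i) ((D ^^ j) g)) \<le> 2 ^ k * B" if "i \<le> m" "j \<le> m" "k = 2 * m - i - j" for i j k
    using that
  proof (induction k arbitrary: i j rule: less_induct)
    case (less k)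
    consider "i = m" | "j = m" | "i < m" "j < m" using less.prems by linarith
    then show ?case
    proof cases
      case 1
      have "nrm ((T ^^ i) ((D ^^ j) g)) \<le> 2 ^ j * nrm ((T ^^ m) g)"
        unfolding comm 1 by (rule D2[OF Tm[OF g]])
      also have "\<dots> \<le> 2 ^ m * nrm ((T ^^ m) g)"
        using less.prems nrm_nonneg by (intro mult_right_mono power_increasing) auto
      finally show ?thesis by (intro up) (simp add: B_def)
    next
      case 2
      have "nrm ((T ^^ i) ((D ^^ j) g)) \<le> nrm ((D ^^ m) g)"
        unfolding 2 by (rule contraction_le[OF contraction_funpow[OF T(2)] Dp[OF g]])
      then show ?thesis by (intro up) (simp add: B_def)
    next
      case 3
      define k' where "k' = k - 1"
      have k': "k = Suc k'" "k' = 2 * m - Suc i - j" "k' = 2 * m - i - Suc j"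
        using less.prems(3) 3 by (auto simp: k'_def)
      have "(T ^^ i) ((D ^^ j) g) = (\<lambda>x. (T ^^ Suc i) ((D ^^ j) g) x + (T ^^ i) ((D ^^ Suc j) g) x)"
      proof -
        have "(D ^^ Suc j) g = (\<lambda>x. (D ^^ j) g x - T ((D ^^ j) g) x)"
          by (simp add: D_apply[of "(D ^^ j) g"])
        moreover have "(T ^^ Suc i) ((D ^^ j) g) = (T ^^ i) (T ((D ^^ j) g))"
          by (simp add: funpow_swap1)
        ultimately show ?thesis
          by (simp only: lin_diff[OF lin_funpow[OF T(1)]]) simp
      qed
      then have "nrm ((T ^^ i) ((D ^^ j) g)) \<le>
          nrm ((T ^^ Suc i) ((D ^^ j) g)) + nrm ((T ^^ i) ((D ^^ Suc j) g))"
        using nrm_add[OF Tm[OF Dp[OF g, of j], of "Suc i"] Tm[OF Dp[OF g, of "Suc j"], of i]] by simp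
      also have "\<dots> \<le> 2 ^ k' * B + 2 ^ k' * B"
        using 3 less.prems k' by (intro add_mono less.IH) auto
      finally show ?thesis by (simp add: k'(1) mult_ac)
    qed
  qed
  from this[of 0 0 "2 * m"] show ?thesis
    by (simp add: B_def power_mult)
qed

section \<open>From the gap at all scales to decay at sublinear times\<close>

definition gap :: "nat \<Rightarrow> bool" where
  "gap x \<longleftrightarrow> (\<forall>s. \<forall>f\<in>V \<rightarrow> S.
     nrm (\<lambda>v. (Q ^^ (s * x)) f v - (Q ^^ (s * (x + 1))) f v) \<le> 1/32 * nrm f)"

text \<open>The lattice path bound is applied with T = Q^s to g = T^(x m) f. The alternative T^m g
  is small by the assumed decay. In the alternative (I - T)^m g each factor I - T is paired with x
  factors T, and \<open>gap\<close> gives 1/32 per pair. The constants match: 2 * 1/64 = 1/32 and 4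
  * 1/32 = 1/8. The time drops from (x + 1) m to x m, while (1/64)^m weakens to its square
  root.\<close>

lemma decay_step:
  assumes gap: "gap x" and dec: "decay (s * ((x + 1) * m)) ((1/64) ^ m)"
  shows "decay (s * (x * m)) ((1/8) ^ m)"
  unfolding decay_def
proof safe
  fix f assume mz: "mean_zero f"
  then have f: "f \<in> V \<rightarrow> S" by (simp add: mean_zero_def)
  define T where "T = Q ^^ s"
  define D where "D = (\<lambda>g v. g v - T g v)"
  have T: "lin T" "contraction T"
    by (simp_all add: T_def lin_funpow[OF lin_Q] contraction_funpow[OF contraction_Q])
  have Tp: "T ^^ k = Q ^^ (s * k)" for k
    by (simp add: T_def funpow_mult)
  have Tm: "(T ^^ i) g \<in> V \<rightarrow> S" if "g \<in> V \<rightarrow> S" for i g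
    using contraction_mem[OF contraction_funpow[OF T(2)] that] .
  have Dm: "D g \<in> V \<rightarrow> S" if "g \<in> V \<rightarrow> S" for g
    using that contraction_mem[OF T(2) that] by (auto simp: D_def intro!: S_diff)
  have comm: "(T ^^ a) ((D ^^ b) g) = (D ^^ b) ((T ^^ a) g)" for a b g
    by (rule funpow_commute) (simp add: D_def lin_diff[OF T(1)])
  have gap': "nrm (D ((T ^^ x) g)) \<le> 1/32 * nrm g" if "g \<in> V \<rightarrow> S" for g
  proof -
    have "D ((T ^^ x) g) = (\<lambda>v. (Q ^^ (s * x)) g v - (Q ^^ (s * (x + 1))) g v)"
      unfolding D_def by (simp add: T_def funpow_mult funpow_add)
    then show ?thesis using gap that by (simp add: gap_def)
  qed
  have "(D ^^ m) ((T ^^ (x * m)) f) \<in> V \<rightarrow> S \<and>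
      nrm ((D ^^ m) ((T ^^ (x * m)) f)) \<le> (1/32) ^ m * nrm f"
  proof (induction m)
    case (Suc m)
    have eq: "(D ^^ Suc m) ((T ^^ (x * Suc m)) f) = D ((T ^^ x) ((D ^^ m) ((T ^^ (x * m)) f)))"
      unfolding comm by (simp add: funpow_add)
    have "nrm (D ((T ^^ x) ((D ^^ m) ((T ^^ (x * m)) f)))) \<le> 1/32 * ((1/32) ^ m * nrm f)"
      using gap'[of "(D ^^ m) ((T ^^ (x * m)) f)"] Suc by linarith
    then show ?case
      unfolding eq using Suc by (simp add: Dm Tm)
  qed (simp add: f)
  then have b1: "nrm ((D ^^ m) ((T ^^ (x * m)) f)) \<le> (1/32) ^ m * nrm f" by simp
  have "(T ^^ m) ((T ^^ (x * m)) f) = (Q ^^ (s * ((x + 1) * m))) f"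
    by (simp add: Tp algebra_simps funpow_add)
  then have b2: "nrm ((T ^^ m) ((T ^^ (x * m)) f)) \<le> (1/64) ^ m * nrm f"
    using dec mz by (simp add: decay_def)
  have "nrm ((T ^^ (x * m)) f) \<le>
      4 ^ m * max (2 ^ m * nrm ((T ^^ m) ((T ^^ (x * m)) f))) (nrm ((D ^^ m) ((T ^^ (x * m)) f)))"
    unfolding D_def by (rule lattice_path_bound[OF T Tm[OF f]])
  also have "\<dots> \<le> 4 ^ m * max (2 ^ m * ((1/64) ^ m * nrm f)) ((1/32) ^ m * nrm f)"
    using b1 b2 by (intro mult_left_mono max.mono) auto
  also have "2 ^ m * ((1/64) ^ m * nrm f) = (1/32) ^ m * nrm f"
    by (simp add: power_mult_distrib[symmetric] mult.assoc[symmetric])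
  also have "4 ^ m * max ((1/32) ^ m * nrm f) ((1/32) ^ m * nrm f) = (1/8) ^ m * nrm f"
    by (simp add: power_mult_distrib[symmetric] mult.assoc[symmetric])
  finally show "nrm ((Q ^^ (s * (x * m))) f) \<le> (1/8) ^ m * nrm f"
    by (simp add: Tp)
qed

text \<open>The threshold is real so that it can be multiplied by the reduction factor; the exponent
  is a power of two because every step halves it.\<close>

definition decay_from :: "real \<Rightarrow> nat \<Rightarrow> bool" where
  "decay_from a i \<longleftrightarrow> (\<forall>R. a \<le> real R \<longrightarrow> decay R ((1/64) ^ (2 ^ i)))"

text \<open>The time shrinks ideally by x / (x + 1). Rounding \<open>s\<close> up to an integer
  costs at most x m, which the lower bound on \<open>a\<close> limits to a / (2 x + 2). The sum of
  both is the stated factor, still below 1.\<close>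

lemma decay_from_step:
  assumes gap: "gap x" and a: "real (2 * x * (x + 1) * 2 ^ Suc i) \<le> a" and dec: "decay_from a (Suc i)"
  shows "decay_from ((2 * real x + 1) / (2 * real x + 2) * a) i"
  unfolding decay_from_def
proof safe
  fix R assume R: "(2 * real x + 1) / (2 * real x + 2) * a \<le> real R"
  define m where "m = (2::nat) ^ Suc i"
  define s where "s = nat \<lceil>a / ((real x + 1) * real m)\<rceil>"
  have m: "0 < m" by (simp add: m_def)
  have a0: "0 \<le> a" using a by (meson of_nat_0_le_iff order_trans)
  have "a / ((real x + 1) * real m) \<le> real s"
    by (simp add: s_def real_nat_ceiling_ge)
  then have "a \<le> real (s * ((x + 1) * m))"
    using m by (subst (asm) pos_divide_le_eq) (simp_all add: algebra_simps add_pos_nonneg)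
  then have "decay (s * ((x + 1) * m)) ((1/64) ^ m)"
    using dec by (simp add: decay_from_def m_def)
  then have d: "decay (s * (x * m)) ((1/8) ^ m)"
    by (rule decay_step[OF gap])
  have "real s \<le> a / ((real x + 1) * real m) + 1"
    using a0 m unfolding s_def by (simp add: of_nat_ceiling)
  then have "real s * (real x * real m) \<le> (a / ((real x + 1) * real m) + 1) * (real x * real m)"
    by (rule mult_right_mono) simp
  also have "\<dots> = (a * real x) * real m / ((real x + 1) * real m) + real x * real m"
    by (simp add: distrib_right)
  also have "\<dots> = real x / (real x + 1) * a + real x * real m"
    using m by (subst mult_divide_mult_cancel_right) (simp_all add: mult.commute)
  also have "real x * real m \<le> a / (2 * real x + 2)"
    using a by (simp add: m_def field_simps)
  also have "real x / (real x + 1) * a + a / (2 * real x + 2) = (2 * real x + 1) / (2 * real x + 2) * a"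
  proof -
    have "real x / (real x + 1) = 2 * real x / (2 * real x + 2)" by (simp add: field_simps)
    then show ?thesis by (simp add: add_divide_distrib algebra_simps)
  qed
  finally have "s * (x * m) \<le> R" using R by (simp flip: of_nat_mult)
  moreover have "(1/8) ^ m = (1/64 :: real) ^ (2 ^ i)"
    by (simp add: m_def power_mult power2_eq_square flip: power_mult_distrib)
  ultimately show "decay R ((1/64) ^ (2 ^ i))"
    using decay_mono[OF d] by simp
qed

text \<open>The size condition on \<open>a\<close> has to hold at every step. It suffices to assume
  it at the start, since the required size halves each time while \<open>a\<close> shrinks only by a
  factor \<rho> \<ge> 1/2.\<close>

lemma decay_from_iterate:
  assumes gap: "gap x" and a: "real (2 * x * (x + 1) * 2 ^ i) \<le> a" and dec: "decay_from a i"
  shows "decay_from (((2 * real x + 1) / (2 * real x + 2)) ^ i * a) 0"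
proof -
  define \<rho> where "\<rho> = (2 * real x + 1) / (2 * real x + 2)"
  have \<rho>: "1/2 \<le> \<rho>" by (simp add: \<rho>_def field_simps)
  have a0: "0 \<le> a" using a by (meson of_nat_0_le_iff order_trans)
  have "decay_from (\<rho> ^ j * a) (i - j)" if "j \<le> i" for j
    using that
  proof (induction j)
    case (Suc j)
    have S: "i - j = Suc (i - Suc j)" using Suc.prems by simp
    have "real (2 * x * (x + 1) * 2 ^ (i - j)) = (1/2) ^ j * real (2 * x * (x + 1) * 2 ^ i)"
    proof -
      have "(2::real) ^ i = 2 ^ (i - j) * 2 ^ j"
        using Suc.prems by (simp flip: power_add)
      then show ?thesis by (simp add: power_divide)
    qed
    also have "\<dots> \<le> (1/2) ^ j * a"
      using a by (intro mult_left_mono) auto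
    also have "\<dots> \<le> \<rho> ^ j * a"
      using \<rho> a0 by (intro mult_right_mono power_mono) auto
    finally have "decay_from (\<rho> * (\<rho> ^ j * a)) (i - Suc j)"
      unfolding \<rho>_def by (intro decay_from_step[OF gap]) (use Suc S in \<open>simp_all add: \<rho>_def\<close>)
    then show ?case by (simp add: mult.assoc)
  qed (simp add: dec)
  from this[of i] show ?thesis by (simp add: \<rho>_def)
qed

text \<open>With \<open>2 ^ i\<close> the largest power of two up to n, about log n steps lead from
  times of order n to times of order \<rho>^i n, and \<rho>^i is a negative power of n. In
  \<open>c\<close>, the 28 serves the Fourier bound at the start, as 2 (5/6)^28 \<le> 1/64, and the
  rest serves the size condition of \<open>decay_from_iterate\<close>.\<close>

lemma decay_of_gap:
  assumes gap: "gap x" and n: "1 \<le> n" and base: "\<And>R. decay R (2 ^ n * (5/6) ^ R)"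
    and R: "(56 + 4 * real x * (real x + 1)) *
      real n powr (1 + log 2 ((2 * real x + 1) / (2 * real x + 2))) \<le> real R"
  shows "decay R (1/64)"
proof -
  define \<rho> where "\<rho> = (2 * real x + 1) / (2 * real x + 2)"
  have \<rho>: "1/2 \<le> \<rho>" "\<rho> \<le> 1" by (simp_all add: \<rho>_def field_simps)
  define c where "c = 28 + 2 * real x * (real x + 1)"
  have c: "0 \<le> c" by (simp add: c_def)
  obtain i where i: "2 ^ i \<le> n" "n < 2 ^ (i + 1)"
    using ex_power_ivl1[of 2 n] n by auto
  have "real (2 ^ i) \<le> real n" "real n < real (2 ^ (i + 1))"
    using i by (simp_all only: of_nat_le_iff of_nat_less_iff)
  then have i': "2 ^ i \<le> real n" "real n < 2 * 2 ^ i"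
    by simp_all
  have dec: "decay_from (c * real n) i"
    unfolding decay_from_def
  proof safe
    fix R assume "c * real n \<le> real R"
    moreover have "28 * real n \<le> c * real n"
      by (intro mult_right_mono) (auto simp: c_def)
    ultimately have R: "28 * n \<le> R" by linarith
    have "2 ^ n * (5/6 :: real) ^ R \<le> 2 ^ n * (5/6) ^ (28 * n)"
      using R by (intro mult_left_mono power_decreasing) auto
    also have "\<dots> = (2 * (5/6) ^ 28) ^ n"
      by (simp add: power_mult_distrib power_mult)
    also have "\<dots> \<le> (1/64) ^ n"
      by (intro power_mono) (auto simp: power_divide)
    also have "\<dots> \<le> (1/64) ^ (2 ^ i)"
      using i by (intro power_decreasing) auto
    finally show "decay R ((1/64) ^ (2 ^ i))"
      using decay_mono[OF base] by blast
  qed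
  have "real (2 * x * (x + 1) * 2 ^ i) = (2 * real x * (real x + 1)) * 2 ^ i"
    by (simp add: algebra_simps)
  also have "\<dots> \<le> c * real n"
    using i'(1) by (intro mult_mono) (auto simp: c_def)
  finally have "decay_from (\<rho> ^ i * (c * real n)) 0"
    unfolding \<rho>_def by (rule decay_from_iterate[OF gap _ dec])
  moreover have "\<rho> ^ i * (c * real n) \<le> real R"
  proof -
    have "\<rho> ^ i = (2 powr log 2 \<rho>) powr real i"
      using \<rho> by (simp add: powr_realpow)
    also have "\<dots> = (2 powr real i) powr log 2 \<rho>"
      unfolding powr_powr by (simp only: mult.commute)
    also have "\<dots> = (2 ^ i) powr log 2 \<rho>"
      by (simp add: powr_realpow)
    \<comment> \<open>The exponent is not positive, so the lower bound n / 2 for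
      \<open>2 ^ i\<close> is the useful one. It costs a factor 1 / \<rho> \<le> 2, which doubles
      \<open>c\<close> in the final constant.\<close>
    also have "\<dots> \<le> (real n / 2) powr log 2 \<rho>"
    proof (rule powr_mono2')
      show "real n / 2 \<le> 2 ^ i"
        using i'(2) by simp
      show "log 2 \<rho> \<le> 0" using \<rho> by simp
      show "0 < real n / 2" using n by simp
    qed
    also have "\<dots> = real n powr log 2 \<rho> / 2 powr log 2 \<rho>"
      by (rule powr_divide)
    also have "\<dots> = real n powr log 2 \<rho> * inverse \<rho>"
    proof -
      have "2 powr log 2 \<rho> = \<rho>" using \<rho> by simp
      then show ?thesis by (simp only: divide_inverse)
    qed
    also have "\<dots> \<le> real n powr log 2 \<rho> * 2"
      using \<rho> by (intro mult_left_mono) (auto simp: field_simps)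
    finally have "\<rho> ^ i * (c * real n) \<le> (real n powr log 2 \<rho> * 2) * (c * real n)"
      using c by (intro mult_right_mono) auto
    also have "\<dots> = (2 * c) * (real n powr (1 + log 2 \<rho>))"
      using n by (simp add: powr_add)
    finally show ?thesis
      using R by (simp add: c_def \<rho>_def algebra_simps)
  qed
  ultimately show ?thesis by (simp add: decay_from_def)
qed

section \<open>Decay from a Fourier expansion\<close>

lemma sum_p_le: "f \<in> V \<rightarrow> S \<Longrightarrow> (\<Sum>x\<in>V. p (f x))\<^sup>2 \<le> real (card V) * (nrm f)\<^sup>2"
  using sum_squared_le_sum_of_squares[of "\<lambda>x. p (f x)" V] by (simp add: nrm_sq mult.commute)

text \<open>Each \<open>\<psi> u\<close> is a common eigenfunction of the translations, with
  eigenvalue \<open>\<Lambda> u\<close> under \<open>Q\<close>; the trivial one drops out on mean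
  zero functions. As X has no orthogonality, the expansion is estimated termwise by the L1 norm of
  \<open>f\<close>, and the passage from L2 to L1 and back loses the factor
  \<open>card V\<close>.\<close>

lemma decay_characters:
  fixes \<psi> :: "'u \<Rightarrow> 'a \<Rightarrow> real" and \<sigma> :: "'u \<Rightarrow> nat \<Rightarrow> real"
  defines "\<Lambda> u \<equiv> 1 / real N * (\<Sum>j<N. (1 + \<sigma> u j) / 2)"
  assumes U: "finite U" "card U = card V" and u0: "u0 \<in> U" "\<And>x. x \<in> V \<Longrightarrow> \<psi> u0 x = 1"
    and mult: "\<And>u j x. u \<in> U \<Longrightarrow> \<psi> u (\<tau> j x) = \<sigma> u j * \<psi> u x"
    and abs1: "\<And>u x. \<bar>\<psi> u x\<bar> \<le> 1"
    and orth: "\<And>x y. x \<in> V \<Longrightarrow> y \<in> V \<Longrightarrow> (\<Sum>u\<in>U. \<psi> u x * \<psi> u y) = (if x = y then real (card V) else 0)"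
    and \<Lambda>: "\<And>u. u \<in> U \<Longrightarrow> u \<noteq> u0 \<Longrightarrow> 0 \<le> \<Lambda> u \<and> \<Lambda> u \<le> q"
    and q: "0 \<le> q"
  shows "decay R (real (card V) * q ^ R)"
  unfolding decay_def
proof safe
  fix f assume mz: "mean_zero f"
  then have f: "f \<in> V \<rightarrow> S" by (simp add: mean_zero_def)
  define v where "v u = (\<Sum>y\<in>V. \<psi> u y *\<^sub>R f y)" for u
  define F where "F u = (\<lambda>x. \<psi> u x *\<^sub>R v u)" for u
  define t where "t = (\<Sum>x\<in>V. p (f x))"
  have p0: "0 \<le> p (f x)" if "x \<in> V" for x using f that by (auto intro: norm_nonneg)
  have t0: "0 \<le> t" unfolding t_def by (rule sum_nonneg) (rule p0)
  have vS: "v u \<in> S" for u unfolding v_def using f by (intro S_sum S_scale) auto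
  have v0: "v u0 = 0" using mz by (simp add: v_def u0 mean_zero_def)
  have vt: "p (v u) \<le> t" for u
  proof -
    have "p (v u) \<le> (\<Sum>y\<in>V. p (\<psi> u y *\<^sub>R f y))"
      unfolding v_def using f fin by (intro p_sum S_scale) auto
    also have "\<dots> = (\<Sum>y\<in>V. \<bar>\<psi> u y\<bar> * p (f y))"
      using f by (intro sum.cong norm_scale) auto
    also have "\<dots> \<le> t"
      unfolding t_def
    proof (rule sum_mono)
      fix y assume "y \<in> V"
      from mult_right_mono[OF abs1 p0[OF this]] show "\<bar>\<psi> u y\<bar> * p (f y) \<le> p (f y)"
        by simp
    qed
    finally show ?thesis .
  qed
  have QF: "Q (F u) = (\<lambda>x. \<Lambda> u *\<^sub>R F u x)" if "u \<in> U" for u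
  proof
    fix x
    have "E j (F u) x = ((1 + \<sigma> u j) / 2) *\<^sub>R F u x" for j
      by (simp add: E_def F_def mult[OF that] algebra_simps add_divide_distrib)
    then show "Q (F u) x = \<Lambda> u *\<^sub>R F u x"
      by (simp add: Q_def \<Lambda>_def flip: scaleR_sum_left)
  qed
  have QFR: "(Q ^^ R) (F u) = (\<lambda>x. (\<Lambda> u ^ R) *\<^sub>R F u x)" if "u \<in> U" for u
    by (induction R) (simp_all add: lin_scale[OF lin_Q] QF[OF that] mult.commute)
  have expand: "real (card V) *\<^sub>R f x = (\<Sum>u\<in>U. F u x)" if x: "x \<in> V" for x
  proof -
    have "(\<Sum>u\<in>U. F u x) = (\<Sum>y\<in>V. (\<Sum>u\<in>U. \<psi> u x * \<psi> u y) *\<^sub>R f y)"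
      unfolding F_def v_def scaleR_sum_right scaleR_sum_left by (subst sum.swap) simp
    also have "\<dots> = (\<Sum>y\<in>V. if x = y then real (card V) *\<^sub>R f y else 0)"
      by (intro sum.cong refl) (simp add: orth x)
    finally show ?thesis using x fin by simp
  qed
  have pt: "p ((Q ^^ R) f x) \<le> q ^ R * t" if x: "x \<in> V" for x
  proof -
    have c: "0 < real (card V)" using x fin by (auto simp: card_gt_0_iff)
    have QS: "(Q ^^ R) f x \<in> S"
      using contraction_mem[OF contraction_funpow[OF contraction_Q] f] x by auto
    have "real (card V) *\<^sub>R (Q ^^ R) f x = (Q ^^ R) (\<lambda>x. real (card V) *\<^sub>R f x) x"
      by (simp add: lin_scale[OF lin_funpow[OF lin_Q]])
    also have "\<dots> = (Q ^^ R) (\<lambda>x. \<Sum>u\<in>U. F u x) x"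
      by (rule Q_pow_cong[OF expand x])
    also have "\<dots> = (\<Sum>u\<in>U. (\<Lambda> u ^ R * \<psi> u x) *\<^sub>R v u)"
      by (simp add: lin_sum[OF lin_funpow[OF lin_Q]] QFR) (simp add: F_def)
    finally have "real (card V) * p ((Q ^^ R) f x) = p (\<Sum>u\<in>U. (\<Lambda> u ^ R * \<psi> u x) *\<^sub>R v u)"
      using norm_scale[OF QS, of "real (card V)"] by simp
    also have "\<dots> \<le> (\<Sum>u\<in>U. p ((\<Lambda> u ^ R * \<psi> u x) *\<^sub>R v u))"
      using U vS by (intro p_sum S_scale) auto
    also have "\<dots> \<le> (\<Sum>u\<in>U. q ^ R * t)"
    proof (rule sum_mono)
      fix u assume u: "u \<in> U"
      show "p ((\<Lambda> u ^ R * \<psi> u x) *\<^sub>R v u) \<le> q ^ R * t"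
      proof (cases "u = u0")
        case True
        then show ?thesis using q t0 by (simp add: v0 norm_0)
      next
        case False
        have "\<bar>\<Lambda> u ^ R * \<psi> u x\<bar> \<le> q ^ R * 1"
          unfolding abs_mult using \<Lambda>[OF u False] abs1
          by (intro mult_mono) (auto simp: power_abs intro: power_mono)
        then have "\<bar>\<Lambda> u ^ R * \<psi> u x\<bar> * p (v u) \<le> q ^ R * t"
          using q vt norm_nonneg[OF vS] by (intro mult_mono) auto
        then show ?thesis by (simp add: norm_scale vS)
      qed
    qed
    also have "\<dots> = real (card V) * (q ^ R * t)" using U by simp
    finally show ?thesis using c by simp
  qed
  have "(nrm ((Q ^^ R) f))\<^sup>2 \<le> (\<Sum>x\<in>V. (q ^ R * t)\<^sup>2)"
    unfolding nrm_sq using pt contraction_mem[OF contraction_funpow[OF contraction_Q] f]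
    by (intro sum_mono power_mono norm_nonneg) auto
  also have "\<dots> = real (card V) * (q ^ R)\<^sup>2 * t\<^sup>2" by (simp add: power_mult_distrib)
  also have "\<dots> \<le> real (card V) * (q ^ R)\<^sup>2 * (real (card V) * (nrm f)\<^sup>2)"
    unfolding t_def by (intro mult_left_mono sum_p_le f) auto
  also have "\<dots> = (real (card V) * q ^ R * nrm f)\<^sup>2" by (simp add: power2_eq_square)
  finally show "nrm ((Q ^^ R) f) \<le> real (card V) * q ^ R * nrm f"
    by (rule power2_le_imp_le) (simp add: q nrm_nonneg)
qed

end

text \<open>With m = 3 k^2 the difference bound and the sign sum estimate give 4 K / k, which is at
  most 1/32 as 128 = 4 * 32. There are 2^m blocks, of which one is omitted; hence x + 1 =
  2^m.\<close>

lemma (in K_walk) gap_K: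
  assumes k: "0 < k" "128 * K \<le> real k"
  shows "gap (2 ^ (3 * k\<^sup>2) - 1)"
  unfolding gap_def
proof safe
  fix s f assume f: "f \<in> V \<rightarrow> S"
  define m where "m = 3 * k\<^sup>2"
  define d where "d = nrm (\<lambda>x. (Q ^^ (s * (2 ^ m - 1))) f x - (Q ^^ (s * 2 ^ m)) f x)"
  have "2 ^ m * real k / 2 * d \<le> signsum m (\<lambda>t. max t 0) * d"
    unfolding m_def d_def by (intro mult_right_mono signsum_pos_part k nrm_nonneg)
  also have "\<dots> \<le> 2 * K * 2 ^ m * nrm f"
    unfolding d_def using k by (intro difference_bound f) (simp add: m_def Suc_le_eq)
  finally have "2 ^ m * (real k * d) \<le> 2 ^ m * (4 * K * nrm f)"
    by (simp add: algebra_simps)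
  then have "real k * d \<le> 4 * K * nrm f" by simp
  also have "\<dots> \<le> real k * (1/32 * nrm f)"
    using mult_right_mono[OF k(2) nrm_nonneg[of f]] by simp
  finally have "d \<le> 1/32 * nrm f" using k by simp
  then show "nrm (\<lambda>v. (Q ^^ (s * (2 ^ (3 * k\<^sup>2) - 1))) f v -
      (Q ^^ (s * (2 ^ (3 * k\<^sup>2) - 1 + 1))) f v) \<le> 1/32 * nrm f"
    by (simp add: d_def m_def)
qed

section \<open>Walk graphs and their Poincare inequality\<close>

context involutions
begin

text \<open>The entries of \<open>(2 * N) ^ r\<close> times the r-th power of \<open>Q\<close>:
  every step chooses an index and then either stays or moves.\<close>

primrec walks :: "nat \<Rightarrow> 'a \<Rightarrow> 'a \<Rightarrow> nat" where
  "walks 0 x y = (if x = y then 1 else 0)"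
| "walks (Suc r) x y = (\<Sum>j<N. walks r x y + walks r (\<tau> j x) y)"

definition walk_graph :: "nat \<Rightarrow> 'a mgraph" where
  "walk_graph r = \<lparr>verts = V, edges = walks r\<rparr>"

text \<open>All translations commute, so one can be carried through the walk to its end point. This
  gives the symmetry of the matrix.\<close>

lemma walks_shift: "walks r (\<tau> i x) y = walks r x (\<tau> i y)"
proof (induction r arbitrary: x)
  case 0
  have "\<tau> i x = y \<longleftrightarrow> x = \<tau> i y" using invol by metis
  then show ?case by simp
next
  case (Suc r)
  then show ?case by (simp add: comm[of _ i x])
qed

lemma walks_sym: "walks r x y = walks r y x"
proof (induction r arbitrary: x y)
  case (Suc r)
  have "walks r (\<tau> j x) y = walks r (\<tau> j y) x" for j
    using walks_shift[of r j x y] Suc by simp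
  then show ?case using Suc[of x y] by simp
qed auto

lemma walks_row: "x \<in> V \<Longrightarrow> (\<Sum>y\<in>V. walks r x y) = (2 * N) ^ r"
proof (induction r arbitrary: x)
  case (Suc r)
  have "(\<Sum>y\<in>V. walks (Suc r) x y) = (\<Sum>j<N. (\<Sum>y\<in>V. walks r x y) + (\<Sum>y\<in>V. walks r (\<tau> j x) y))"
    by (simp add: sum.distrib sum.swap[of _ _ V] sum_distrib_left)
  also have "\<dots> = (2 * N) ^ Suc r"
    by (simp add: Suc closed)
  finally show ?case .
qed (simp add: fin)

lemma regular_walk_graph: "regular_of_degree ((2 * N) ^ r) (walk_graph r)"
  by (auto simp: regular_of_degree_def is_mgraph_def vdegree_def walk_graph_def fin walks_row
      intro: walks_sym)

end

section \<open>From decay to the Poincare inequality\<close>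

context walk
begin

lemma walks_Q:
  assumes "x \<in> V"
  shows "(\<Sum>y\<in>V. real (walks r x y) *\<^sub>R f y) = real ((2 * N) ^ r) *\<^sub>R (Q ^^ r) f x"
  using assms
proof (induction r arbitrary: x)
  case 0
  have "(\<Sum>y\<in>V. real (walks 0 x y) *\<^sub>R f y) = (\<Sum>y\<in>V. if x = y then f y else 0)"
    by (intro sum.cong) auto
  then show ?case using 0 fin by simp
next
  case (Suc r)
  have "(\<Sum>y\<in>V. real (walks (Suc r) x y) *\<^sub>R f y) =
      (\<Sum>j<N. (\<Sum>y\<in>V. real (walks r x y) *\<^sub>R f y) + (\<Sum>y\<in>V. real (walks r (\<tau> j x) y) *\<^sub>R f y))"
    by (simp only: walks.simps of_nat_sum of_nat_add scaleR_sum_left scaleR_add_left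
        sum.distrib sum.swap[of _ V])
  also have "\<dots> = real ((2 * N) ^ r) *\<^sub>R (\<Sum>j<N. 2 *\<^sub>R E j ((Q ^^ r) f) x)"
    using Suc by (simp add: closed E_def scaleR_sum_right scaleR_add_right)
  also have "\<dots> = real ((2 * N) ^ Suc r) *\<^sub>R (Q ^^ Suc r) f x"
    using N_pos by (simp add: Q_def mult_ac flip: scaleR_sum_right)
  finally show ?case .
qed

text \<open>The triangle inequality reduces this to numbers, where the difference of the two sides
  is a variance.\<close>

lemma jensen:
  assumes y: "y \<in> V \<rightarrow> S" and v: "v \<in> S" and a: "\<And>j. j \<in> V \<Longrightarrow> 0 \<le> a j" "(\<Sum>j\<in>V. a j) = 1"
  shows "(p (v - (\<Sum>j\<in>V. a j *\<^sub>R y j)))\<^sup>2 \<le> (\<Sum>j\<in>V. a j * (p (v - y j))\<^sup>2)"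
proof -
  define q where "q j = p (v - y j)" for j
  define \<mu> where "\<mu> = (\<Sum>j\<in>V. a j * q j)"
  have d: "v - y j \<in> S" if "j \<in> V" for j using y v that by (auto intro!: S_diff)
  have "v - (\<Sum>j\<in>V. a j *\<^sub>R y j) = (\<Sum>j\<in>V. a j *\<^sub>R (v - y j))"
    using a(2) by (simp add: scaleR_diff_right sum_subtractf flip: scaleR_sum_left)
  also have "p \<dots> \<le> (\<Sum>j\<in>V. p (a j *\<^sub>R (v - y j)))"
    using d by (intro p_sum fin S_scale)
  also have "\<dots> = \<mu>"
    unfolding \<mu>_def q_def using a d by (intro sum.cong) (simp_all add: norm_scale)
  finally have "(p (v - (\<Sum>j\<in>V. a j *\<^sub>R y j)))\<^sup>2 \<le> \<mu>\<^sup>2"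
    using y v by (intro power_mono norm_nonneg S_diff S_sum S_scale) auto
  moreover have "0 \<le> (\<Sum>j\<in>V. a j * (q j - \<mu>)\<^sup>2)"
    using a by (intro sum_nonneg) auto
  moreover have "(\<Sum>j\<in>V. a j * (q j - \<mu>)\<^sup>2) = (\<Sum>j\<in>V. a j * (q j)\<^sup>2) - \<mu>\<^sup>2"
  proof -
    have "(\<Sum>j\<in>V. a j * (q j - \<mu>)\<^sup>2) =
        (\<Sum>j\<in>V. a j * (q j)\<^sup>2) - 2 * \<mu> * (\<Sum>j\<in>V. a j * q j) + \<mu>\<^sup>2 * (\<Sum>j\<in>V. a j)"
      by (simp add: power2_diff algebra_simps sum.distrib sum_subtractf sum_distrib_left sum_distrib_right)
    then show ?thesis
      unfolding \<mu>_def[symmetric] a(2) by (simp add: power2_eq_square)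
  qed
  ultimately show ?thesis
    unfolding q_def by linarith
qed

text \<open>By Jensen, the energy \<Theta> controls x - Q^r y and y - Q^r x. Only the combination of
  both compares \<open>x\<close> with itself, after 2 r steps; hence the even exponent in
  \<open>dec\<close>. Telescoping k such comparisons and using the decay bounds the distance of
  \<open>x\<close> and of \<open>y\<close> to their means. The distance of the means is bounded
  directly, and (a + b + c)^2 \<le> 3 (a^2 + b^2 + c^2) joins the three parts: 32 k^2 + 1 = 16 k^2 +
  1 + 16 k^2.\<close>

lemma poincare_of_decay:
  assumes x: "x \<in> V \<rightarrow> S" and y: "y \<in> V \<rightarrow> S" and dec: "decay (2 * k * r) (1/2)"
    and a: "\<And>i j. 0 \<le> a i j" "\<And>i. i \<in> V \<Longrightarrow> (\<Sum>j\<in>V. a i j) = 1" "\<And>i j. a i j = a j i"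
    and Q: "\<And>i f. i \<in> V \<Longrightarrow> (Q ^^ r) f i = (\<Sum>j\<in>V. a i j *\<^sub>R f j)"
  shows "(\<Sum>i\<in>V. \<Sum>j\<in>V. (p (x i - y j))\<^sup>2) \<le>
    real (card V) * (3 * (32 * (real k)\<^sup>2 + 1)) * (\<Sum>i\<in>V. \<Sum>j\<in>V. a i j * (p (x i - y j))\<^sup>2)"
proof (cases "V = {}")
  case False
  define M where "M = real (card V)"
  define \<Theta> where "\<Theta> = (\<Sum>i\<in>V. \<Sum>j\<in>V. a i j * (p (x i - y j))\<^sup>2)"
  define mean :: "('a \<Rightarrow> 'v) \<Rightarrow> 'v" where "mean f = (1 / M) *\<^sub>R (\<Sum>i\<in>V. f i)" for f
  have M: "0 < M" using False fin by (simp add: M_def card_gt_0_iff)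
  have \<Theta>0: "0 \<le> \<Theta>" unfolding \<Theta>_def using a by (intro sum_nonneg) auto
  have Qm: "(Q ^^ t) f \<in> V \<rightarrow> S" if "f \<in> V \<rightarrow> S" for t f
    using contraction_mem[OF contraction_funpow[OF contraction_Q] that] .
  have Qle: "nrm ((Q ^^ t) f) \<le> nrm f" if "f \<in> V \<rightarrow> S" for t f
    using contraction_le[OF contraction_funpow[OF contraction_Q] that] .
  have meanS: "mean f \<in> S" if "f \<in> V \<rightarrow> S" for f
    using that by (auto simp: mean_def intro!: S_scale S_sum)
  have one: "(nrm (\<lambda>i. u i - (Q ^^ r) w i))\<^sup>2 \<le> (\<Sum>i\<in>V. \<Sum>j\<in>V. a i j * (p (u i - w j))\<^sup>2)"
    if "u \<in> V \<rightarrow> S" "w \<in> V \<rightarrow> S" for u w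
    unfolding nrm_sq using that a by (intro sum_mono) (auto simp: Q intro!: jensen)
  have xy: "(nrm (\<lambda>i. x i - (Q ^^ r) y i))\<^sup>2 \<le> \<Theta>"
    unfolding \<Theta>_def by (rule one[OF x y])
  have yx: "(nrm (\<lambda>i. y i - (Q ^^ r) x i))\<^sup>2 \<le> \<Theta>"
  proof -
    have "p (y i - x j) = p (x j - y i)" if "i \<in> V" "j \<in> V" for i j
      using p_minus[of "x j - y i"] x y that by (auto intro!: S_diff)
    then have "(\<Sum>i\<in>V. \<Sum>j\<in>V. a i j * (p (y i - x j))\<^sup>2) = (\<Sum>i\<in>V. \<Sum>j\<in>V. a j i * (p (x j - y i))\<^sup>2)"
      by (intro sum.cong refl arg_cong2[where f = "(*)"] a) simp
    also have "\<dots> = \<Theta>" unfolding \<Theta>_def by (rule sum.swap)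
    finally show ?thesis using one[OF y x] by simp
  qed
  have center: "(nrm (\<lambda>i. u i - mean u))\<^sup>2 \<le> 16 * (real k)\<^sup>2 * \<Theta>"
    if u: "u \<in> V \<rightarrow> S" and w: "w \<in> V \<rightarrow> S"
      and uw: "(nrm (\<lambda>i. u i - (Q ^^ r) w i))\<^sup>2 \<le> \<Theta>" and wu: "(nrm (\<lambda>i. w i - (Q ^^ r) u i))\<^sup>2 \<le> \<Theta>"
    for u w
  proof -
    define T where "T = sqrt \<Theta>"
    have uw': "nrm (\<lambda>i. u i - (Q ^^ r) w i) \<le> T" and wu': "nrm (\<lambda>i. w i - (Q ^^ r) u i) \<le> T"
      using uw wu real_le_rsqrt by (auto simp: T_def)
    define z where "z = (\<lambda>i. u i - (Q ^^ (2 * r)) u i)"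
    have zm: "z \<in> V \<rightarrow> S" using u Qm[OF u] by (auto simp: z_def intro!: S_diff)
    have wum: "(\<lambda>i. w i - (Q ^^ r) u i) \<in> V \<rightarrow> S" and uwm: "(\<lambda>i. u i - (Q ^^ r) w i) \<in> V \<rightarrow> S"
      using u w Qm[OF u, of r] Qm[OF w, of r] by (auto intro!: S_diff)
    have "z = (\<lambda>i. (u i - (Q ^^ r) w i) + (Q ^^ r) (\<lambda>i. w i - (Q ^^ r) u i) i)"
      unfolding z_def lin_diff[OF lin_funpow[OF lin_Q]] by (simp add: mult_2 funpow_add)
    then have "nrm z \<le> nrm (\<lambda>i. u i - (Q ^^ r) w i) + nrm ((Q ^^ r) (\<lambda>i. w i - (Q ^^ r) u i))"
      using nrm_add[OF uwm Qm[OF wum]] by simp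
    then have zT: "nrm z \<le> 2 * T"
      using uw' wu' Qle[OF wum, of r] by simp
    have tel: "nrm (\<lambda>i. u i - (Q ^^ (2 * k * r)) u i) \<le> real k * (2 * T)" for k
    proof (induction k)
      case (Suc k)
      have "(\<lambda>i. u i - (Q ^^ (2 * Suc k * r)) u i) =
          (\<lambda>i. (u i - (Q ^^ (2 * k * r)) u i) + (Q ^^ (2 * k * r)) z i)"
        unfolding z_def lin_diff[OF lin_funpow[OF lin_Q]]
        by (simp add: algebra_simps flip: funpow_add[THEN fun_cong, unfolded comp_def])
      then have "nrm (\<lambda>i. u i - (Q ^^ (2 * Suc k * r)) u i) \<le>
          nrm (\<lambda>i. u i - (Q ^^ (2 * k * r)) u i) + nrm ((Q ^^ (2 * k * r)) z)"
        using nrm_add[of "\<lambda>i. u i - (Q ^^ (2 * k * r)) u i" "(Q ^^ (2 * k * r)) z"]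
          u Qm[OF u] Qm[OF zm] by (auto intro!: S_diff)
      also have "\<dots> \<le> real k * (2 * T) + 2 * T"
        using Suc zT Qle[OF zm, of "2 * k * r"] by linarith
      finally show ?case by (simp add: algebra_simps)
    qed (simp add: nrm_0)
    define u0 where "u0 = (\<lambda>i. u i - mean u)"
    have u0m: "u0 \<in> V \<rightarrow> S" using u meanS[OF u] by (auto simp: u0_def intro!: S_diff)
    have "(\<Sum>i\<in>V. u0 i) = 0"
      using M by (simp add: u0_def mean_def sum_subtractf M_def sum_constant_scaleR)
    then have "nrm ((Q ^^ (2 * k * r)) u0) \<le> 1/2 * nrm u0"
      using dec u0m by (simp add: decay_def mean_zero_def)
    \<comment> \<open>Constants are fixed by \<open>Q\<close>, so the telescoped estimate for
      \<open>u\<close> applies to the centered function.\<close>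
    moreover have "(\<lambda>i. u0 i - (Q ^^ (2 * k * r)) u0 i) = (\<lambda>i. u i - (Q ^^ (2 * k * r)) u i)"
      unfolding u0_def lin_diff[OF lin_funpow[OF lin_Q]] Q_pow_const by simp
    moreover have "nrm u0 \<le> nrm (\<lambda>i. u0 i - (Q ^^ (2 * k * r)) u0 i) + nrm ((Q ^^ (2 * k * r)) u0)"
      using nrm_add[of "\<lambda>i. u0 i - (Q ^^ (2 * k * r)) u0 i" "(Q ^^ (2 * k * r)) u0"]
        u0m Qm[OF u0m] by (auto intro!: S_diff)
    ultimately have "nrm u0 \<le> 4 * real k * T"
      using tel[of k] by (simp add: algebra_simps)
    then have "(nrm u0)\<^sup>2 \<le> (4 * real k * T)\<^sup>2"
      by (rule power_mono) (rule nrm_nonneg)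
    also have "\<dots> = 16 * (real k)\<^sup>2 * \<Theta>" using \<Theta>0 by (simp add: T_def power_mult_distrib)
    finally show ?thesis by (simp add: u0_def)
  qed
  define X where "X i = p (x i - mean x)" for i
  define Y where "Y i = p (y i - mean y)" for i
  define m where "m = p (mean x - mean y)"
  have m0: "0 \<le> m" unfolding m_def by (intro norm_nonneg S_diff meanS x y)
  \<comment> \<open>\<open>Q\<close> preserves sums, so the difference of the means is the mean of x
    - Q^r y.\<close>
  have mM: "M * m\<^sup>2 \<le> \<Theta>"
  proof -
    define d where "d = (\<lambda>i. x i - (Q ^^ r) y i)"
    have dm: "d \<in> V \<rightarrow> S" using x Qm[OF y] by (auto simp: d_def intro!: S_diff)
    have sumQ: "(\<Sum>i\<in>V. (Q ^^ t) y i) = (\<Sum>i\<in>V. y i)" for t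
      by (induction t) (simp_all add: sum_Q)
    have "M * m = p (M *\<^sub>R (mean x - mean y))"
      unfolding m_def using M by (subst norm_scale) (auto intro!: S_diff meanS x y)
    also have "M *\<^sub>R (mean x - mean y) = (\<Sum>i\<in>V. d i)"
      using M by (simp add: mean_def d_def sum_subtractf sumQ scaleR_diff_right)
    also have "p \<dots> \<le> (\<Sum>i\<in>V. p (d i))" using dm fin by (intro p_sum) auto
    finally have "(M * m)\<^sup>2 \<le> (\<Sum>i\<in>V. p (d i))\<^sup>2"
      using M m0 by (intro power_mono) auto
    also have "\<dots> \<le> M * (nrm d)\<^sup>2" unfolding M_def by (rule sum_p_le[OF dm])
    also have "\<dots> \<le> M * \<Theta>" using xy M by (simp add: d_def)
    finally have "M * (M * m\<^sup>2) \<le> M * \<Theta>" by (simp add: power2_eq_square mult_ac)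
    then show ?thesis using M by simp
  qed
  have XY: "(\<Sum>i\<in>V. (X i)\<^sup>2) \<le> 16 * (real k)\<^sup>2 * \<Theta>" "(\<Sum>i\<in>V. (Y i)\<^sup>2) \<le> 16 * (real k)\<^sup>2 * \<Theta>"
    using center[OF x y xy yx] center[OF y x yx xy] by (simp_all add: nrm_sq X_def Y_def)
  have pt: "(p (x i - y j))\<^sup>2 \<le> 3 * ((X i)\<^sup>2 + m\<^sup>2 + (Y j)\<^sup>2)" if ij: "i \<in> V" "j \<in> V" for i j
  proof -
    have S1: "x i - mean x \<in> S" "y j - mean y \<in> S" "mean x - mean y \<in> S" "x i - y j \<in> S"
      using x y ij meanS[OF x] meanS[OF y] by (auto intro!: S_diff)
    have "x i - y j = ((x i - mean x) + (mean x - mean y)) - (y j - mean y)" by simp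
    then have "p (x i - y j) \<le> p ((x i - mean x) + (mean x - mean y)) + Y j"
      unfolding Y_def using p_diff[OF S_add[OF S1(1,3)] S1(2)] by simp
    then have "p (x i - y j) \<le> X i + m + Y j"
      unfolding X_def m_def using norm_triangle[OF S1(1,3)] by simp
    then have "(p (x i - y j))\<^sup>2 \<le> (X i + m + Y j)\<^sup>2"
      by (rule power_mono) (rule norm_nonneg[OF S1(4)])
    moreover have "0 \<le> (X i - m)\<^sup>2 + (m - Y j)\<^sup>2 + (X i - Y j)\<^sup>2" by simp
    ultimately show ?thesis by (simp add: power2_eq_square algebra_simps)
  qed
  have "(\<Sum>i\<in>V. \<Sum>j\<in>V. (p (x i - y j))\<^sup>2) \<le> (\<Sum>i\<in>V. \<Sum>j\<in>V. 3 * ((X i)\<^sup>2 + m\<^sup>2 + (Y j)\<^sup>2))"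
    by (intro sum_mono pt)
  also have "\<dots> = 3 * M * ((\<Sum>i\<in>V. (X i)\<^sup>2) + M * m\<^sup>2 + (\<Sum>i\<in>V. (Y i)\<^sup>2))"
    by (simp add: sum.distrib M_def algebra_simps flip: sum_distrib_left)
  also have "\<dots> \<le> 3 * M * (16 * (real k)\<^sup>2 * \<Theta> + \<Theta> + 16 * (real k)\<^sup>2 * \<Theta>)"
    using M XY mM by (intro mult_left_mono add_mono) auto
  also have "\<dots> = M * (3 * (32 * (real k)\<^sup>2 + 1)) * \<Theta>" by (simp add: algebra_simps)
  finally show ?thesis by (simp add: M_def \<Theta>_def)
qed simp

lemma gamma_plus_walk_graph:
  assumes V: "V \<noteq> {}" and dec: "decay (2 * k * r) (1/2)"
  shows "gamma_plus_graph (walk_graph r) S (\<lambda>x y. (p (x - y))\<^sup>2) \<le> ereal (3 * (32 * (real k)\<^sup>2 + 1))"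
  unfolding gamma_plus_graph_def gamma_plus_def
proof (rule Inf_lower, simp only: mem_Collect_eq, intro exI conjI ballI)
  let ?g = "3 * (32 * (real k)\<^sup>2 + 1)"
  let ?A = "norm_adj (walk_graph r)"
  show "0 < ?g" by (simp add: add_nonneg_pos)
  fix x y assume "x \<in> verts (walk_graph r) \<rightarrow> S" "y \<in> verts (walk_graph r) \<rightarrow> S"
  then have xy: "x \<in> V \<rightarrow> S" "y \<in> V \<rightarrow> S" by (simp_all add: walk_graph_def)
  define d where "d = real ((2 * N) ^ r)"
  define a where "a i j = real (walks r i j) / d" for i j
  have d: "0 < d" using N_pos by (simp add: d_def)
  have A: "?A i j = a i j" if "i \<in> V" for i j
    using that by (simp add: norm_adj_def vdegree_def walk_graph_def walks_row a_def d_def)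
  have c: "0 < real (card V)" using V fin by (simp add: card_gt_0_iff)
  have "(\<Sum>i\<in>V. \<Sum>j\<in>V. (p (x i - y j))\<^sup>2) \<le> real (card V) * ?g * (\<Sum>i\<in>V. \<Sum>j\<in>V. a i j * (p (x i - y j))\<^sup>2)"
  proof (rule poincare_of_decay[OF xy dec])
    show "0 \<le> a i j" for i j using d by (simp add: a_def)
    show "a i j = a j i" for i j by (simp add: a_def walks_sym)
    show "(\<Sum>j\<in>V. a i j) = 1" if "i \<in> V" for i
      using d N_pos walks_row[OF that, of r] by (simp add: a_def d_def flip: sum_divide_distrib of_nat_sum)
    show "(Q ^^ r) f i = (\<Sum>j\<in>V. a i j *\<^sub>R f j)" if "i \<in> V" for i f
    proof -
      have "(\<Sum>j\<in>V. a i j *\<^sub>R f j) = (1 / d) *\<^sub>R (\<Sum>j\<in>V. real (walks r i j) *\<^sub>R f j)"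
        by (simp add: a_def scaleR_sum_right)
      then show ?thesis using d N_pos by (simp add: walks_Q[OF that] d_def)
    qed
  qed
  also have "(\<Sum>i\<in>V. \<Sum>j\<in>V. a i j * (p (x i - y j))\<^sup>2) = (\<Sum>i\<in>V. \<Sum>j\<in>V. ?A i j * (p (x i - y j))\<^sup>2)"
    by (intro sum.cong) (simp_all add: A)
  finally show "1 / (real (card (verts (walk_graph r))))\<^sup>2 *
      (\<Sum>i\<in>verts (walk_graph r). \<Sum>j\<in>verts (walk_graph r). (p (x i - y j))\<^sup>2)
      \<le> ?g / real (card (verts (walk_graph r))) *
      (\<Sum>i\<in>verts (walk_graph r). \<Sum>j\<in>verts (walk_graph r). ?A i j * (p (x i - y j))\<^sup>2)"
    using c by (simp add: walk_graph_def[of r] field_simps power2_eq_square)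
qed simp

end

section \<open>The expander family\<close>

text \<open>The character (-1)^<u, x> of binary vectors of length \<open>n\<close>. These are coded
  as naturals below \<open>2 ^ n\<close>, with \<open>xor\<close> as addition.\<close>

definition character :: "nat \<Rightarrow> nat \<Rightarrow> nat \<Rightarrow> real" where
  "character n u x = (\<Prod>i<n. if bit u i \<and> bit x i then - 1 else 1)"

lemma character_commute: "character n u x = character n x u"
  by (simp add: character_def conj_commute)

lemma character_xor: "character n u (xor x y) = character n u x * character n u y"
  unfolding character_def prod.distrib[symmetric] by (intro prod.cong) (auto simp: bit_xor_iff)

lemma character_0: "character n 0 x = 1"
  by (simp add: character_def)

lemma character_cases: "character n u x = 1 \<or> character n u x = - 1"
  unfolding character_def by (induction n) auto

lemma xor_less_exp: "x < 2 ^ n \<Longrightarrow> y < 2 ^ n \<Longrightarrow> xor x y < (2 ^ n :: nat)"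
  by (metis take_bit_nat_eq_self_iff take_bit_xor)

text \<open>Flipping in \<open>u\<close> a bit that is set in \<open>z\<close> changes the sign of
  the summand and permutes the range.\<close>

lemma sum_character:
  assumes z: "z < 2 ^ n" "z \<noteq> 0"
  shows "(\<Sum>u<2 ^ n. character n u z) = 0"
proof -
  obtain i where i: "bit z i"
    using z(2) by (metis bit_0_eq bit_eq_iff bot_apply bot_bool_def)
  have "take_bit n z = z"
    using z(1) by (simp add: take_bit_nat_eq_self_iff)
  with i have "i < n"
    by (metis bit_take_bit_iff)
  have "character n (2 ^ i) z = (\<Prod>j<n. if j = i then - 1 else 1)"
    unfolding character_def using i by (intro prod.cong) (auto simp: bit_exp_iff)
  also have "\<dots> = - 1"
    using \<open>i < n\<close> by (simp add: prod.delta)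
  finally have flip: "character n (xor u (2 ^ i)) z = - character n u z" for u
    using character_xor[of n z u "2 ^ i"] by (simp add: character_commute[of n z])
  have xx: "xor (xor u (2 ^ i)) (2 ^ i) = u" for u :: nat
    by (simp add: xor.assoc)
  have "bij_betw (\<lambda>u. xor u (2 ^ i)) {..<2 ^ n} {..<2 ^ n :: nat}"
    by (rule bij_betwI[of _ _ _ "\<lambda>u. xor u (2 ^ i)"]) (use \<open>i < n\<close> in \<open>auto intro!: xor_less_exp simp: xx\<close>)
  from sum.reindex_bij_betw[OF this, of "\<lambda>u. character n u z"]
  show ?thesis by (simp add: flip sum_negf)
qed

lemma character_orthogonal:
  assumes "x < 2 ^ n" "y < 2 ^ n"
  shows "(\<Sum>u<2 ^ n. character n u x * character n u y) = (if x = y then 2 ^ n else 0)"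
proof (cases "x = y")
  case True
  have "character n u y * character n u y = 1" for u
    using character_cases[of n u y] by auto
  with True show ?thesis by simp
next
  case False
  have "xor x y \<noteq> 0"
    using False by (metis xor.assoc xor.left_neutral xor_self_eq xor.right_neutral)
  then show ?thesis
    using False sum_character[OF xor_less_exp[OF assms]] by (simp add: character_xor)
qed

text \<open>The derandomized union bound: each word is chosen so that \<open>\<Sum>u. 4 ^ (- weight u)\<close> over the nonzero
  messages \<open>u\<close> drops by the average factor \<open>(1 + 1/4) / 2\<close>.\<close>

lemma greedy_code:
  "\<exists>g. (\<forall>j. g j < 2 ^ n) \<and>
    (\<Sum>u\<in>{0<..<2 ^ n}. \<Prod>j<k. (5 + 3 * character n u (g j)) / 8) \<le> 2 ^ n * (5/8) ^ k"
proof (induction k)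
  case 0
  show ?case by (intro exI[of _ "\<lambda>_. 0"]) simp
next
  case (Suc k)
  then obtain g where g: "\<And>j. g j < 2 ^ n"
    "(\<Sum>u\<in>{0<..<2 ^ n}. \<Prod>j<k. (5 + 3 * character n u (g j)) / 8) \<le> 2 ^ n * (5/8) ^ k"
    by auto
  \<comment> \<open>The factor (5 + 3 \<chi>) / 8 is 1 for \<chi> = 1 and 1/4 for \<chi> = -1, so
    the product is 1/4 to the power of the weight.\<close>
  define a where "a u = (\<Prod>j<k. (5 + 3 * character n u (g j)) / 8)" for u
  define \<Phi> where "\<Phi> h = (\<Sum>u\<in>{0<..<2 ^ n}. a u * ((5 + 3 * character n u h) / 8))" for h
  have "(\<Sum>h<2 ^ n. \<Phi> h) = (\<Sum>u\<in>{0<..<2 ^ n}. a u * (\<Sum>h<2 ^ n. (5 + 3 * character n u h) / 8))"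
    unfolding \<Phi>_def by (subst sum.swap) (simp add: sum_distrib_left)
  also have "\<dots> = (\<Sum>u\<in>{0<..<2 ^ n}. a u * (5/8 * 2 ^ n))"
  proof (intro sum.cong refl arg_cong2[where f = "(*)"])
    fix u :: nat assume u: "u \<in> {0<..<2 ^ n}"
    have "(\<Sum>h<2 ^ n. character n u h) = 0"
      using sum_character[of u n] u by (simp add: character_commute)
    then show "(\<Sum>h<2 ^ n. (5 + 3 * character n u h) / 8) = 5/8 * 2 ^ n"
      by (simp add: sum.distrib flip: sum_divide_distrib sum_distrib_left)
  qed
  also have "\<dots> = (\<Sum>h<2 ^ n::nat. 5/8 * (\<Sum>u\<in>{0<..<2 ^ n}. a u))"
    unfolding sum_distrib_right[symmetric] by simp
  finally have eq: "(\<Sum>h<2 ^ n. \<Phi> h) = (\<Sum>h<2 ^ n::nat. 5/8 * (\<Sum>u\<in>{0<..<2 ^ n}. a u))" .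
  obtain h where h: "h < 2 ^ n" "\<Phi> h \<le> 5/8 * (\<Sum>u\<in>{0<..<2 ^ n}. a u)"
  proof (rule ccontr)
    assume "\<not> thesis"
    with that have *: "5/8 * (\<Sum>u\<in>{0<..<2 ^ n}. a u) < \<Phi> h" if "h < 2 ^ n" for h
      using \<open>h < 2 ^ n\<close> not_le by blast
    have "(\<Sum>h<2 ^ n::nat. 5/8 * (\<Sum>u\<in>{0<..<2 ^ n}. a u)) < (\<Sum>h<2 ^ n. \<Phi> h)"
      by (rule sum_strict_mono) (use * in \<open>auto simp: lessThan_empty_iff\<close>)
    with eq show False by simp
  qed
  have "(\<Sum>u\<in>{0<..<2 ^ n}. \<Prod>j<Suc k. (5 + 3 * character n u ((g(k := h)) j)) / 8) = \<Phi> h"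
    by (simp add: \<Phi>_def a_def)
  also have "\<dots> \<le> 5/8 * (2 ^ n * (5/8) ^ k)"
    using h(2) g(2) by (simp add: a_def)
  finally show ?case
    using g(1) h(1) by (intro exI[of _ "g(k := h)"]) simp
qed

text \<open>The sum counts the coordinates where the codeword of \<open>u\<close> vanishes: every
  nonzero codeword of length 3 n has weight at least n / 2. Divided by 3 n, the bound becomes the
  eigenvalue bound 5/6.\<close>

definition good_code :: "nat \<Rightarrow> (nat \<Rightarrow> nat) \<Rightarrow> bool" where
  "good_code n g \<longleftrightarrow> (\<forall>j. g j < 2 ^ n) \<and>
     (\<forall>u. 0 < u \<and> u < 2 ^ n \<longrightarrow> (\<Sum>j<3 * n. (1 + character n u (g j)) / 2) \<le> 5/2 * real n)"

text \<open>One term is at most the total, so 4^(- weight) \<le> 2^n (5/8)^(3 n). Length 3 n is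
  chosen because (5/8)^3 = 125/512 lies below 1/4; the right side is then at most 2^(-n), and the
  weight is at least n / 2.\<close>

lemma good_code_exists: "\<exists>g. good_code n g"
proof -
  obtain g where g: "\<And>j. g j < 2 ^ n"
    "(\<Sum>u\<in>{0<..<2 ^ n}. \<Prod>j<3 * n. (5 + 3 * character n u (g j)) / 8) \<le> 2 ^ n * (5/8) ^ (3 * n)"
    using greedy_code[of n "3 * n"] by auto
  have "(\<Sum>j<3 * n. (1 + character n u (g j)) / 2) \<le> 5/2 * real n" if u: "0 < u" "u < 2 ^ n" for u
  proof -
    define w :: "nat \<Rightarrow> nat" where "w j = (if character n u (g j) = 1 then 0 else 1)" for j
    define W where "W = (\<Sum>j<3 * n. w j)"
    have nonneg: "0 \<le> 5 + 3 * character n u' (g j)" for u' j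
      using character_cases[of n u' "g j"] by auto
    have "(1/4 :: real) ^ W = (\<Prod>j<3 * n. (1/4) ^ w j)"
      by (simp add: W_def power_sum)
    also have "\<dots> = (\<Prod>j<3 * n. (5 + 3 * character n u (g j)) / 8)"
      by (intro prod.cong refl) (use character_cases in \<open>fastforce simp: w_def\<close>)
    also have "\<dots> \<le> (\<Sum>u\<in>{0<..<2 ^ n}. \<Prod>j<3 * n. (5 + 3 * character n u (g j)) / 8)"
      using u by (intro member_le_sum prod_nonneg) (auto simp: nonneg)
    also have "\<dots> \<le> 2 ^ n * (125/512) ^ n"
      using g(2) by (simp add: power_mult power3_eq_cube)
    also have "\<dots> \<le> 2 ^ n * (1/4) ^ n"
      by (intro mult_left_mono power_mono) auto
    also have "\<dots> = (1/2) ^ n"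
      by (simp flip: power_mult_distrib)
    finally have "(1/2 :: real) ^ (2 * W) \<le> (1/2) ^ n"
      by (simp add: power_mult power2_eq_square)
    then have "n \<le> 2 * W"
      using power_decreasing_iff[of "1/2 :: real" "2 * W" n] by simp
    moreover have "(\<Sum>j<3 * n. (1 + character n u (g j)) / 2) = (\<Sum>j<3 * n. 1 - real (w j))"
      by (intro sum.cong refl) (use character_cases in \<open>fastforce simp: w_def\<close>)
    moreover have "\<dots> = 3 * real n - real W"
      by (simp add: sum_subtractf W_def)
    ultimately show ?thesis by linarith
  qed
  with g(1) show ?thesis by (auto simp: good_code_def)
qed

section \<open>Cayley graphs of the code and bounds for their constants\<close>

definition code :: "nat \<Rightarrow> nat \<Rightarrow> nat" where
  "code n = (SOME g. good_code n g)"

lemma good_code_code: "good_code n (code n)"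
  unfolding code_def using good_code_exists by (rule someI_ex)

definition translate :: "nat \<Rightarrow> nat \<Rightarrow> nat \<Rightarrow> nat" where
  "translate n j x = xor x (code n j)"

lemma involutions_code: "1 \<le> n \<Longrightarrow> involutions {..<2 ^ n} (translate n) (3 * n)"
proof
  fix i j x
  show "translate n j (translate n j x) = x"
    by (simp add: translate_def xor.assoc)
  show "translate n i (translate n j x) = translate n j (translate n i x)"
    by (simp add: translate_def xor.assoc xor.commute[of "code n i"])
  show "x \<in> {..<2 ^ n} \<Longrightarrow> translate n j x \<in> {..<2 ^ n}"
    using good_code_code[of n] by (auto simp: translate_def good_code_def intro: xor_less_exp)
qed auto

definition expander :: "nat \<Rightarrow> nat \<Rightarrow> nat mgraph" where
  "expander n r = involutions.walk_graph {..<2 ^ n} (translate n) (3 * n) r"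

lemma regular_expander:
  assumes "1 \<le> n"
  shows "regular_of_degree ((6 * n) ^ r) (expander n r)" "verts (expander n r) = {..<2 ^ n}"
proof -
  interpret involutions "{..<2 ^ n}" "translate n" "3 * n"
    by (rule involutions_code[OF assms])
  show "regular_of_degree ((6 * n) ^ r) (expander n r)" "verts (expander n r) = {..<2 ^ n}"
    using regular_walk_graph[of r] by (simp_all add: expander_def walk_graph_def)
qed

lemma decay_code:
  assumes "banach_on S p" and n: "1 \<le> n"
  shows "walk.decay S p {..<2 ^ n} (translate n) (3 * n) R (2 ^ n * (5/6) ^ R)"
proof -
  interpret banach_on S p by fact
  interpret involutions "{..<2 ^ n}" "translate n" "3 * n"
    by (rule involutions_code[OF n])
  interpret walk S p "{..<2 ^ n}" "translate n" "3 * n" ..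
  have "decay R (real (card {..<2 ^ n :: nat}) * (5/6) ^ R)"
  proof (rule decay_characters[where U = "{..<2 ^ n}" and \<psi> = "character n" and
        \<sigma> = "\<lambda>u j. character n u (code n j)" and ?u0.0 = 0])
    fix u assume u: "u \<in> {..<2 ^ n :: nat}" "u \<noteq> 0"
    have "0 \<le> (\<Sum>j<3 * n. (1 + character n u (code n j)) / 2)"
      by (rule sum_nonneg) (use character_cases in \<open>fastforce\<close>)
    moreover have "(\<Sum>j<3 * n. (1 + character n u (code n j)) / 2) \<le> 5/2 * real n"
      using good_code_code[of n] u by (simp add: good_code_def)
    ultimately show "0 \<le> 1 / real (3 * n) * (\<Sum>j<3 * n. (1 + character n u (code n j)) / 2) \<and>
        1 / real (3 * n) * (\<Sum>j<3 * n. (1 + character n u (code n j)) / 2) \<le> 5/6"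
      using n by (auto simp: divide_le_eq)
  next
    show "\<bar>character n u x\<bar> \<le> 1" for u x
      using character_cases[of n u x] by auto
    show "character n u (translate n j x) = character n u (code n j) * character n u x" for u j x
      by (simp add: translate_def character_xor)
  qed (auto simp: character_0 character_orthogonal)
  then show ?thesis by simp
qed

text \<open>The Fourier bound alone suffices, in any Banach space: 8 n steps contract because 2
  (5/6)^8 \<le> 1/2. The resulting constant grows like n^2.\<close>

lemma gamma_plus_expander_finite:
  assumes "banach_on S p" and n: "1 \<le> n" and r: "1 \<le> r"
  shows "gamma_plus_graph (expander n r) S (\<lambda>x y. (p (x - y))\<^sup>2) < \<infinity>"
proof -
  interpret banach_on S p by fact
  interpret involutions "{..<2 ^ n}" "translate n" "3 * n"
    by (rule involutions_code[OF n])
  interpret walk S p "{..<2 ^ n}" "translate n" "3 * n" ..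
  have "2 ^ n * (5/6 :: real) ^ (2 * (4 * n) * r) \<le> 2 ^ n * (5/6) ^ (8 * n)"
    using r by (intro mult_left_mono power_decreasing) auto
  also have "\<dots> = (2 * (5/6) ^ 8) ^ n"
    by (simp add: power_mult power_mult_distrib)
  also have "\<dots> \<le> (1/2) ^ n"
    by (intro power_mono) (auto simp: power_divide)
  also have "\<dots> \<le> (1/2) ^ 1"
    using n by (intro power_decreasing) auto
  finally have "decay (2 * (4 * n) * r) (1/2)"
    using decay_mono[OF decay_code[OF assms(1) n] order_refl] by simp
  from gamma_plus_walk_graph[OF _ this, unfolded lessThan_empty_iff]
  have "gamma_plus_graph (expander n r) S (\<lambda>x y. (p (x - y))\<^sup>2) \<le> ereal (3 * (32 * (real (4 * n))\<^sup>2 + 1))"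
    by (simp add: expander_def)
  then show ?thesis
    by (rule le_less_trans) simp
qed

lemma K_convex_bound:
  assumes "banach_on S p" "K_convex S p"
  obtains K where "0 \<le> K" "\<And>m F. 1 \<le> m \<Longrightarrow> F \<in> cube m \<rightarrow> S \<Longrightarrow>
      (\<Sum>e\<in>cube m. (p (Rad m F e))\<^sup>2) \<le> K\<^sup>2 * (\<Sum>e\<in>cube m. (p (F e))\<^sup>2)"
proof -
  interpret banach_on S p by fact
  obtain K0 where K0: "K_const S p \<le> ereal K0"
    using assms(2) by (cases "K_const S p") (auto simp: K_convex_def)
  define K where "K = max 0 K0"
  have "(\<Sum>e\<in>cube m. (p (Rad m F e))\<^sup>2) \<le> K\<^sup>2 * (\<Sum>e\<in>cube m. (p (F e))\<^sup>2)"
    if m: "1 \<le> m" and F: "F \<in> cube m \<rightarrow> S" for m F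
  \<comment> \<open>Here the quotient in \<open>K_const\<close> is 0 / 0 = 0 and carries no
    information, but then \<open>F\<close> vanishes on the cube.\<close>
  proof (cases "L2norm m p F = 0")
    case True
    then have "(\<Sum>e\<in>cube m. (p (F e))\<^sup>2) = 0"
      by (simp add: L2norm_def)
    then have "F e = 0" if "e \<in> cube m" for e
      using that F norm_eq_0[of "F e"] by (subst (asm) sum_nonneg_eq_0_iff) auto
    then have "Rad m F e = 0" for e
      by (simp add: Rad_def fourier_def)
    then show ?thesis
      by (simp add: norm_0 sum_nonneg)
  next
    case False
    have pos: "0 < L2norm m p F"
      using False by (simp add: L2norm_def sum_nonneg order.not_eq_order_implies_strict)
    have "ereal (L2norm m p (Rad m F) / L2norm m p F) \<le> K_const S p"
      unfolding K_const_def using m F by (intro SUP_upper2[of m] SUP_upper2[of F]) auto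
    with K0 have "ereal (L2norm m p (Rad m F) / L2norm m p F) \<le> ereal K0"
      by (rule order_trans[rotated])
    then have "L2norm m p (Rad m F) / L2norm m p F \<le> K"
      by (simp add: K_def)
    then have "L2norm m p (Rad m F) \<le> K * L2norm m p F"
      using pos by (simp add: divide_le_eq)
    then have "(L2norm m p (Rad m F))\<^sup>2 \<le> (K * L2norm m p F)\<^sup>2"
      by (rule power_mono) (simp add: L2norm_def sum_nonneg)
    then show ?thesis
      by (simp add: L2norm_def power_mult_distrib sum_nonneg divide_right_mono field_simps)
  qed
  moreover have "0 \<le> K" by (simp add: K_def)
  ultimately show thesis by (rule that[rotated])
qed

text \<open>X enters only through K, which determines x, and thereby C and \<beta> = - log 2 \<rho>.
  Once r steps contract, the Poincare inequality applies with k = 1 and gives 3 * 33 = 99, below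
  9^3.\<close>

lemma gamma_plus_expander_bound:
  assumes "banach_on S p" "K_convex S p"
  obtains C \<beta> where "0 < C" "0 < \<beta>"
    "\<And>n r. 1 \<le> n \<Longrightarrow> C * real n powr (1 - \<beta>) \<le> real r \<Longrightarrow>
      gamma_plus_graph (expander n r) S (\<lambda>x y. (p (x - y))\<^sup>2) \<le> 9 ^ 3"
proof -
  interpret banach_on S p by fact
  obtain K where K: "0 \<le> K" "\<And>m F. 1 \<le> m \<Longrightarrow> F \<in> cube m \<rightarrow> S \<Longrightarrow>
      (\<Sum>e\<in>cube m. (p (Rad m F e))\<^sup>2) \<le> K\<^sup>2 * (\<Sum>e\<in>cube m. (p (F e))\<^sup>2)"
    using K_convex_bound[OF assms] by metis
  define k where "k = Suc (nat \<lceil>128 * K\<rceil>)"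
  have k: "0 < k" "128 * K \<le> real k"
    unfolding k_def using real_nat_ceiling_ge[of "128 * K"] by (simp_all add: of_nat_Suc del: of_nat_ceiling)
  define x where "x = (2 :: nat) ^ (3 * k\<^sup>2) - 1"
  define \<rho> where "\<rho> = (2 * real x + 1) / (2 * real x + 2)"
  define C where "C = 56 + 4 * real x * (real x + 1)"
  have \<rho>: "0 < \<rho>" "\<rho> < 1" by (simp_all add: \<rho>_def divide_pos_pos add_nonneg_pos)
  show thesis
  proof (rule that[of C "- log 2 \<rho>"])
    show "0 < C" by (simp add: C_def add_pos_nonneg)
    show "0 < - log 2 \<rho>" using \<rho> by simp
    fix n r :: nat
    assume n: "1 \<le> n" and r: "C * real n powr (1 - - log 2 \<rho>) \<le> real r"
    interpret involutions "{..<2 ^ n}" "translate n" "3 * n"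
      by (rule involutions_code[OF n])
    interpret K_walk S p "{..<2 ^ n}" "translate n" "3 * n" K
      by unfold_locales (fact K)+
    have "decay r (1/64)"
      by (rule decay_of_gap[OF gap_K[OF k] n decay_code[OF assms(1) n]])
        (use r in \<open>simp add: C_def \<rho>_def x_def\<close>)
    then have "decay (2 * 1 * r) (1/2)"
      by (rule decay_mono) auto
    from gamma_plus_walk_graph[OF _ this, unfolded lessThan_empty_iff]
    have "gamma_plus_graph (expander n r) S (\<lambda>x y. (p (x - y))\<^sup>2) \<le> ereal (3 * (32 * (real 1)\<^sup>2 + 1))"
      by (simp add: expander_def)
    also have "\<dots> \<le> ereal (9 ^ 3)" by simp
    also have "ereal (9 ^ 3) = 9 ^ 3" by simp
    finally show "gamma_plus_graph (expander n r) S (\<lambda>x y. (p (x - y))\<^sup>2) \<le> 9 ^ 3" .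
  qed
qed

text \<open>The real r for which the degree (6 n)^r equals the permitted exp((ln 2^n)^(1 -
  \<delta>)).\<close>

definition steps_bound :: "real \<Rightarrow> nat \<Rightarrow> real" where
  "steps_bound \<delta> n = ln (real (2 ^ n)) powr (1 - \<delta>) / ln (6 * real n)"

definition steps :: "real \<Rightarrow> nat \<Rightarrow> nat" where
  "steps \<delta> n = nat \<lfloor>steps_bound \<delta> n\<rfloor>"

text \<open>The two bounds by n^\<delta> later absorb the logarithm in \<open>steps_bound\<close>
  and the constant C of the space. At \<delta> = 1 the value of \<open>steps_bound\<close> is 1 / ln
  (6 n) < 1 and the walk has length 0; therefore the last condition is restricted to \<delta> <
  1.\<close>

definition large :: "real \<Rightarrow> nat \<Rightarrow> bool" where
  "large \<delta> n \<longleftrightarrow> 1 \<le> n \<and> ln (6 * real n) \<le> real n powr \<delta> \<and> 1 / \<delta> \<le> real n powr \<delta> \<and>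
     (\<delta> < 1 \<longrightarrow> 1 \<le> steps_bound \<delta> n)"

definition threshold :: "real \<Rightarrow> nat" where
  "threshold \<delta> = (SOME n0. \<forall>n\<ge>n0. large \<delta> n)"

lemma large_threshold:
  assumes "0 < \<delta>" "threshold \<delta> \<le> n"
  shows "large \<delta> n"
proof -
  have "\<forall>\<^sub>F n in sequentially. 1 \<le> (n::nat)"
    by (rule eventually_ge_at_top)
  moreover have "\<forall>\<^sub>F n in sequentially. ln (6 * real n) \<le> real n powr \<delta>"
    using assms(1) by real_asymp
  moreover have "\<forall>\<^sub>F n in sequentially. 1 / \<delta> \<le> real n powr \<delta>"
    using assms(1) by real_asymp
  moreover have "\<forall>\<^sub>F n in sequentially. \<delta> < 1 \<longrightarrow> 1 \<le> steps_bound \<delta> n"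
  proof (cases "\<delta> < 1")
    case True
    then have "\<forall>\<^sub>F n in sequentially. 1 \<le> (real n * ln 2) powr (1 - \<delta>) / ln (6 * real n)"
      by real_asymp
    then show ?thesis
      by eventually_elim (simp add: steps_bound_def ln_realpow)
  qed simp
  ultimately have "\<forall>\<^sub>F n in sequentially. large \<delta> n"
    unfolding large_def by eventually_elim blast
  then have "\<exists>n0. \<forall>n\<ge>n0. large \<delta> n"
    by (simp add: eventually_sequentially)
  from someI_ex[OF this] assms(2) show ?thesis
    by (simp add: threshold_def)
qed

lemma gap_bounds_expander:
  assumes "banach_on S p" "K_convex S p"
  shows "gap_bounds threshold (\<lambda>\<delta> n. expander n (steps \<delta> n)) S p"
  unfolding gap_bounds_def
proof (intro conjI ballI allI impI)
  fix \<delta> :: real and n assume \<delta>: "\<delta> \<in> {0<..<1}" and n: "threshold \<delta> \<le> n"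
  then have "large \<delta> n" by (intro large_threshold) auto
  then have "1 \<le> n" "1 \<le> steps \<delta> n"
    using \<delta> by (auto simp: large_def steps_def le_nat_floor)
  then show "gamma_plus_graph (expander n (steps \<delta> n)) S (\<lambda>x y. (p (x - y))\<^sup>2) < \<infinity>"
    by (rule gamma_plus_expander_finite[OF assms(1)])
next
  obtain C \<beta> where C: "0 < C" and \<beta>: "0 < \<beta>" and gamma: "\<And>n r. 1 \<le> n \<Longrightarrow> C * real n powr (1 - \<beta>) \<le> real r \<Longrightarrow>
      gamma_plus_graph (expander n r) S (\<lambda>x y. (p (x - y))\<^sup>2) \<le> 9 ^ 3"
    using gamma_plus_expander_bound[OF assms] by metis
  \<comment> \<open>The saving n^\<beta> pays for three factors n^\<delta>: the degree restriction,
    the logarithm and the constant C. The 4 in 1 / (4 C) covers two losses of a factor 2, one from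
    the power of ln 2 and one from rounding down.\<close>
  define \<delta>0 where "\<delta>0 = min (1/2) (min (\<beta> / 3) (1 / (4 * C)))"
  have \<delta>0: "\<delta>0 \<in> {0<..<1}" using C \<beta> by (auto simp: \<delta>0_def)
  show "\<exists>\<delta>0\<in>{0<..<1}. \<forall>\<delta>\<in>{0<..\<delta>0}. \<forall>n\<ge>threshold \<delta>.
      gamma_plus_graph (expander n (steps \<delta> n)) S (\<lambda>x y. (p (x - y))\<^sup>2) \<le> 9 ^ 3"
  proof (intro bexI[OF _ \<delta>0] ballI allI impI)
    fix \<delta> :: real and n assume \<delta>: "\<delta> \<in> {0<..\<delta>0}" and "threshold \<delta> \<le> n"
    then have large: "large \<delta> n" by (intro large_threshold) auto
    have \<delta>': "0 < \<delta>" "\<delta> \<le> 1/2" "3 * \<delta> \<le> \<beta>" "\<delta> \<le> 1 / (4 * C)"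
      using \<delta> by (auto simp: \<delta>0_def)
    have n: "1 \<le> n" and ln: "ln (6 * real n) \<le> real n powr \<delta>" and inv: "1 / \<delta> \<le> real n powr \<delta>"
      and one: "1 \<le> steps_bound \<delta> n"
      using large \<delta>' by (auto simp: large_def)
    have ln0: "0 < ln (6 * real n)" using n by simp
    have "C * real n powr (1 - \<beta>) \<le> C * real n powr (1 - 3 * \<delta>)"
      using n \<delta>' C by (intro mult_left_mono powr_mono) auto
    also have "\<dots> \<le> 1/4 * (1 / \<delta>) * real n powr (1 - 3 * \<delta>)"
      using \<delta>' C by (intro mult_right_mono) (simp_all add: field_simps)
    also have "1/4 * (1 / \<delta>) * real n powr (1 - 3 * \<delta>) \<le> 1/4 * real n powr \<delta> * real n powr (1 - 3 * \<delta>)"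
      using inv by (intro mult_right_mono mult_left_mono) auto
    also have "\<dots> = 1/2 * (1/2 * real n powr (1 - \<delta>) / real n powr \<delta>)"
      using n by (simp add: powr_diff powr_add[symmetric] field_simps)
    also have "\<dots> \<le> 1/2 * (ln 2 powr (1 - \<delta>) * real n powr (1 - \<delta>) / ln (6 * real n))"
    proof -
      have "1/2 \<le> ln (2::real)" using ln2_ge_two_thirds by simp
      also have "ln (2::real) = ln 2 powr 1" by simp
      also have "\<dots> \<le> ln 2 powr (1 - \<delta>)"
        using \<delta>' ln_2_less_1 by (intro powr_mono') auto
      finally show ?thesis
        using ln ln0 by (intro mult_left_mono frac_le mult_right_mono) auto
    qed
    also have "\<dots> = 1/2 * steps_bound \<delta> n"
      using n by (simp add: steps_bound_def ln_realpow powr_mult mult.commute)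
    \<comment> \<open>The floor of a real number that is at least 1 is more than half of it.\<close>
    also have "\<dots> \<le> real (steps \<delta> n)"
    proof -
      have "1 \<le> real_of_int \<lfloor>steps_bound \<delta> n\<rfloor>" using one by simp
      moreover have "steps_bound \<delta> n < real_of_int \<lfloor>steps_bound \<delta> n\<rfloor> + 1" by linarith
      moreover have "real (steps \<delta> n) = real_of_int \<lfloor>steps_bound \<delta> n\<rfloor>"
        using one by (simp add: steps_def)
      ultimately show ?thesis by linarith
    qed
    finally have "C * real n powr (1 - \<beta>) \<le> real (steps \<delta> n)" .
    then show "gamma_plus_graph (expander n (steps \<delta> n)) S (\<lambda>x y. (p (x - y))\<^sup>2) \<le> 9 ^ 3"
      by (rule gamma[OF n])
  qed
qed

lemma graph_family_expander:
  "graph_family (\<lambda>n. 2 ^ n) threshold (\<lambda>\<delta> n. expander n (steps \<delta> n))"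
  unfolding graph_family_def
proof (intro conjI ballI allI impI)
  show "strict_mono_on {1..} (\<lambda>n. 2 ^ n :: nat)"
    by (simp add: strict_mono_on_def)
  show "2 powr (real n / 10) \<le> real (2 ^ n)" for n
  proof -
    have "2 powr (real n / 10) \<le> (2 :: real) powr real n" by (intro powr_mono) auto
    then show ?thesis by (simp add: powr_realpow)
  qed
  fix \<delta> :: real assume \<delta>: "\<delta> \<in> {0<..1}"
  show "1 \<le> threshold \<delta>"
    using large_threshold[of \<delta> "threshold \<delta>"] \<delta> by (simp add: large_def)
  fix n assume "threshold \<delta> \<le> n"
  then have n: "1 \<le> n"
    using large_threshold[of \<delta> n] \<delta> by (simp add: large_def)
  show "card (verts (expander n (steps \<delta> n))) = 2 ^ n"
    by (simp add: regular_expander(2)[OF n])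
  have ln0: "0 < ln (6 * real n)" using n by simp
  have "real ((6 * n) ^ steps \<delta> n) = exp (ln (6 * real n)) ^ steps \<delta> n"
    using n by simp
  also have "\<dots> = exp (real (steps \<delta> n) * ln (6 * real n))"
    by (simp add: exp_of_nat_mult)
  also have "\<dots> \<le> exp (steps_bound \<delta> n * ln (6 * real n))"
  proof -
    have "0 \<le> steps_bound \<delta> n" using ln0 by (simp add: steps_bound_def)
    then have "real (steps \<delta> n) \<le> steps_bound \<delta> n"
      by (simp add: steps_def)
    then show ?thesis using ln0 by simp
  qed
  also have "\<dots> = exp (ln (real (2 ^ n)) powr (1 - \<delta>))"
    using ln0 by (simp add: steps_bound_def)
  finally show "\<exists>d. regular_of_degree d (expander n (steps \<delta> n)) \<and>
      real d \<le> exp (ln (real (2 ^ n)) powr (1 - \<delta>))"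
    using regular_expander(1)[OF n, of "steps \<delta> n"] by blast
qed simp_all

section \<open>Reduction to separable spaces\<close>

definition violates :: "'i set \<Rightarrow> ('i \<Rightarrow> 'i \<Rightarrow> real) \<Rightarrow> ('x \<Rightarrow> 'x \<Rightarrow> real) \<Rightarrow> real \<Rightarrow> ('i \<Rightarrow> 'x) \<Rightarrow> ('i \<Rightarrow> 'x) \<Rightarrow> bool" where
  "violates I A K g x y \<longleftrightarrow>
     g / real (card I) * (\<Sum>i\<in>I. \<Sum>j\<in>I. A i j * K (x i) (y j))
       < 1 / (real (card I))\<^sup>2 * (\<Sum>i\<in>I. \<Sum>j\<in>I. K (x i) (y j))"

lemma gamma_plus_violates:
  assumes "0 < c" "ereal c < gamma_plus I A X K"
  obtains x y where "x \<in> I \<rightarrow> X" "y \<in> I \<rightarrow> X" "violates I A K c x y"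
proof (rule ccontr)
  assume "\<not> thesis"
  with that have "\<not> violates I A K c x y" if "x \<in> I \<rightarrow> X" "y \<in> I \<rightarrow> X" for x y
    using \<open>x \<in> I \<rightarrow> X\<close> \<open>y \<in> I \<rightarrow> X\<close> by blast
  then have "gamma_plus I A X K \<le> ereal c"
    unfolding gamma_plus_def violates_def not_less using assms(1) by (intro Inf_lower) blast
  with assms(2) show False by simp
qed

text \<open>The right side of the inequality grows with the constant, because the energy is
  nonnegative. So a pair that violates it for \<open>c\<close> also violates it for everything
  smaller.\<close>

lemma violates_gamma_plus:
  assumes xy: "x \<in> I \<rightarrow> X" "y \<in> I \<rightarrow> X" "violates I A K c x y"
    and A: "\<And>i j. 0 \<le> A i j" and K: "\<And>x y. x \<in> X \<Longrightarrow> y \<in> X \<Longrightarrow> 0 \<le> K x y"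
  shows "ereal c \<le> gamma_plus I A X K"
  unfolding gamma_plus_def
proof (rule Inf_greatest, clarify, unfold ereal_less_eq)
  fix g assume "\<forall>x\<in>I \<rightarrow> X. \<forall>y\<in>I \<rightarrow> X.
      1 / (real (card I))\<^sup>2 * (\<Sum>i\<in>I. \<Sum>j\<in>I. K (x i) (y j))
        \<le> g / real (card I) * (\<Sum>i\<in>I. \<Sum>j\<in>I. A i j * K (x i) (y j))"
  with xy(1,2) have "1 / (real (card I))\<^sup>2 * (\<Sum>i\<in>I. \<Sum>j\<in>I. K (x i) (y j))
      \<le> g / real (card I) * (\<Sum>i\<in>I. \<Sum>j\<in>I. A i j * K (x i) (y j))" by blast
  with xy(3) have "c / real (card I) * (\<Sum>i\<in>I. \<Sum>j\<in>I. A i j * K (x i) (y j)) <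
      g / real (card I) * (\<Sum>i\<in>I. \<Sum>j\<in>I. A i j * K (x i) (y j))"
    unfolding violates_def by linarith
  then have less: "\<not> g / real (card I) * (\<Sum>i\<in>I. \<Sum>j\<in>I. A i j * K (x i) (y j)) \<le>
      c / real (card I) * (\<Sum>i\<in>I. \<Sum>j\<in>I. A i j * K (x i) (y j))"
    by simp
  have "0 \<le> (\<Sum>i\<in>I. \<Sum>j\<in>I. A i j * K (x i) (y j))"
    using xy(1,2) by (intro sum_nonneg mult_nonneg_nonneg A K) auto
  with less have "\<not> g / real (card I) \<le> c / real (card I)"
    by (blast intro: mult_right_mono)
  then show "c \<le> g"
    by (cases "c \<le> g") (simp_all add: divide_right_mono)
qed

lemma norm_adj_nonneg: "0 \<le> norm_adj G i j"
  by (simp add: norm_adj_def)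

text \<open>For each positive rational below the constant of \<open>X\<close>, one violating pair is
  kept. A pair has finitely many values, and on any \<open>Y\<close> containing all of them the
  constant exceeds or equals each of these rationals.\<close>

lemma gamma_plus_countable:
  assumes I: "finite I" and A: "\<And>i j. 0 \<le> A i j"
    and K: "\<And>x y. x \<in> X \<Longrightarrow> y \<in> X \<Longrightarrow> 0 \<le> K x y"
  obtains C where "countable C" "C \<subseteq> X"
    "\<And>Y. C \<subseteq> Y \<Longrightarrow> Y \<subseteq> X \<Longrightarrow> gamma_plus I A X K \<le> gamma_plus I A Y K"
proof -
  define R where "R = {c :: rat. 0 < c \<and> ereal (of_rat c) < gamma_plus I A X K}"
  have "\<forall>c\<in>R. \<exists>x y. x \<in> I \<rightarrow> X \<and> y \<in> I \<rightarrow> X \<and> violates I A K (of_rat c) x y"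
    by (auto simp: R_def elim!: gamma_plus_violates[rotated])
  then obtain x y where xy: "\<And>c. c \<in> R \<Longrightarrow> x c \<in> I \<rightarrow> X \<and> y c \<in> I \<rightarrow> X \<and> violates I A K (of_rat c) (x c) (y c)"
    by metis
  define C where "C = (\<Union>c\<in>R. x c ` I \<union> y c ` I)"
  show thesis
  proof (rule that[of C])
    show "countable C"
      unfolding C_def using I by (intro countable_UN countable_Un countable_image) (auto simp: countable_finite)
    show "C \<subseteq> X"
      using xy by (auto simp: C_def)
    fix Y assume Y: "C \<subseteq> Y" "Y \<subseteq> X"
    have low: "ereal (of_rat c) \<le> gamma_plus I A Y K" if "c \<in> R" for c
      by (rule violates_gamma_plus[of "x c" _ _ "y c"]) (use xy[OF that] that Y A in \<open>auto simp: C_def intro!: K\<close>)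
    show "gamma_plus I A X K \<le> gamma_plus I A Y K"
    proof (rule ccontr)
      assume "\<not> gamma_plus I A X K \<le> gamma_plus I A Y K"
      then have less: "gamma_plus I A Y K < gamma_plus I A X K" by simp
      have nonneg: "0 \<le> gamma_plus I A Y K"
        unfolding gamma_plus_def by (rule Inf_greatest) auto
      \<comment> \<open>The constant of \<open>X\<close> may be infinite, so two reals are inserted
        first to make room for a rational.\<close>
      obtain r where r: "gamma_plus I A Y K < ereal r" "ereal r < gamma_plus I A X K"
        using less ereal_dense2 by blast
      obtain r' where r': "ereal r < ereal r'" "ereal r' < gamma_plus I A X K"
        using r(2) ereal_dense2 by blast
      obtain c where c: "r < of_rat c" "of_rat c < r'"
        using of_rat_dense[of r r'] r'(1) by auto
      have "0 < ereal r" using nonneg r(1) by (rule le_less_trans)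
      then have "0 < r" by simp
      then have "(0::real) < of_rat c" using c(1) by (rule less_trans)
      moreover have "ereal (of_rat c) < gamma_plus I A X K"
        using c(2) r'(2) by (meson ereal_less_eq(3) le_less_trans less_imp_le)
      ultimately have "c \<in> R" by (simp add: R_def)
      from le_less_trans[OF low[OF this] r(1)] c(1) show False by simp
    qed
  qed
qed

text \<open>A failure of finiteness is visible at one pair (\<delta>, n). A failure of the uniform
  bound gives a bad pair below every \<delta>0, and bad pairs below a sequence tending to 0 already
  refute every \<delta>0. In both cases countably many graphs are involved.\<close>

lemma gap_bounds_countable:
  fixes S :: "'v::real_vector set"
  assumes H: "\<And>\<delta> n. 0 < \<delta> \<Longrightarrow> \<delta> < 1 \<Longrightarrow> n0 \<delta> \<le> n \<Longrightarrow> finite (verts (H \<delta> n))"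
    and no: "\<not> gap_bounds n0 H S p"
  obtains C where "countable C" "C \<subseteq> S"
    "\<And>Y. C \<subseteq> Y \<Longrightarrow> Y \<subseteq> S \<Longrightarrow> \<not> gap_bounds n0 H Y p"
proof -
  let ?K = "\<lambda>x y. (p (x - y))\<^sup>2"
  define P where "P \<delta> n C \<longleftrightarrow> countable C \<and> C \<subseteq> S \<and> (\<forall>Y. C \<subseteq> Y \<longrightarrow> Y \<subseteq> S \<longrightarrow>
      gamma_plus_graph (H \<delta> n) S ?K \<le> gamma_plus_graph (H \<delta> n) Y ?K)" for \<delta> n C
  define C where "C \<delta> n = (SOME C. P \<delta> n C)" for \<delta> n
  have P: "P \<delta> n (C \<delta> n)" if "0 < \<delta>" "\<delta> < 1" "n0 \<delta> \<le> n" for \<delta> n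
    unfolding C_def
  proof (rule someI_ex, rule gamma_plus_countable[OF H[OF that] norm_adj_nonneg])
    show "0 \<le> ?K x y" for x y :: 'v by simp
    fix C assume "countable C" "C \<subseteq> S"
      "\<And>Y. C \<subseteq> Y \<Longrightarrow> Y \<subseteq> S \<Longrightarrow>
        gamma_plus (verts (H \<delta> n)) (norm_adj (H \<delta> n)) S ?K \<le> gamma_plus (verts (H \<delta> n)) (norm_adj (H \<delta> n)) Y ?K"
    then have "P \<delta> n C"
      by (simp add: P_def gamma_plus_graph_def)
    then show "\<exists>C. P \<delta> n C" ..
  qed
  then have C: "\<And>\<delta> n. 0 < \<delta> \<Longrightarrow> \<delta> < 1 \<Longrightarrow> n0 \<delta> \<le> n \<Longrightarrow> countable (C \<delta> n)"
    "\<And>\<delta> n. 0 < \<delta> \<Longrightarrow> \<delta> < 1 \<Longrightarrow> n0 \<delta> \<le> n \<Longrightarrow> C \<delta> n \<subseteq> S"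
    "\<And>\<delta> n Y. 0 < \<delta> \<Longrightarrow> \<delta> < 1 \<Longrightarrow> n0 \<delta> \<le> n \<Longrightarrow> C \<delta> n \<subseteq> Y \<Longrightarrow> Y \<subseteq> S \<Longrightarrow>
      gamma_plus_graph (H \<delta> n) S ?K \<le> gamma_plus_graph (H \<delta> n) Y ?K"
    by (simp_all add: P_def)
  show thesis
  proof (cases "\<forall>\<delta>\<in>{0<..<1}. \<forall>n\<ge>n0 \<delta>. gamma_plus_graph (H \<delta> n) S ?K < \<infinity>")
    case False
    then obtain \<delta> n where \<delta>: "0 < \<delta>" "\<delta> < 1" "n0 \<delta> \<le> n" and inf: "\<not> gamma_plus_graph (H \<delta> n) S ?K < \<infinity>"
      by auto
    show thesis
    proof (rule that[OF C(1,2)[OF \<delta>]])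
      fix Y assume "C \<delta> n \<subseteq> Y" "Y \<subseteq> S"
      from C(3)[OF \<delta> this] inf have "\<not> gamma_plus_graph (H \<delta> n) Y ?K < \<infinity>"
        by auto
      with \<delta> show "\<not> gap_bounds n0 H Y p"
        unfolding gap_bounds_def by force
    qed
  next
    case True
    have "\<exists>\<delta> n. 0 < \<delta> \<and> \<delta> \<le> \<delta>0 \<and> n0 \<delta> \<le> n \<and> \<not> gamma_plus_graph (H \<delta> n) S ?K \<le> 9 ^ 3"
      if "0 < \<delta>0" "\<delta>0 < 1" for \<delta>0
      using no True that unfolding gap_bounds_def by (metis greaterThanAtMost_iff greaterThanLessThan_iff)
    then obtain d n where d: "\<And>\<delta>0. 0 < \<delta>0 \<Longrightarrow> \<delta>0 < 1 \<Longrightarrow> 0 < d \<delta>0 \<and> d \<delta>0 \<le> \<delta>0 \<and> n0 (d \<delta>0) \<le> n \<delta>0 \<and>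
        \<not> gamma_plus_graph (H (d \<delta>0) (n \<delta>0)) S ?K \<le> 9 ^ 3"
      by metis
    \<comment> \<open>The shift by 2 keeps the value strictly below 1 at k = 0.\<close>
    define \<epsilon> where "\<epsilon> k = 1 / real (k + 2)" for k
    have \<epsilon>: "0 < \<epsilon> k" "\<epsilon> k < 1" for k by (simp_all add: \<epsilon>_def)
    have d': "0 < d (\<epsilon> k)" "d (\<epsilon> k) < 1" "n0 (d (\<epsilon> k)) \<le> n (\<epsilon> k)" "d (\<epsilon> k) \<le> \<epsilon> k" for k
      using d[OF \<epsilon>[of k]] \<epsilon>[of k] by auto
    show thesis
    proof (rule that[of "\<Union>k. C (d (\<epsilon> k)) (n (\<epsilon> k))"])
      show "countable (\<Union>k. C (d (\<epsilon> k)) (n (\<epsilon> k)))"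
        by (rule countable_UN) (auto intro: C(1) d')
      show "(\<Union>k. C (d (\<epsilon> k)) (n (\<epsilon> k))) \<subseteq> S"
        using C(2)[OF d'(1-3)] by blast
      fix Y assume Y: "(\<Union>k. C (d (\<epsilon> k)) (n (\<epsilon> k))) \<subseteq> Y" "Y \<subseteq> S"
      have big: "\<not> gamma_plus_graph (H (d (\<epsilon> k)) (n (\<epsilon> k))) Y ?K \<le> 9 ^ 3" for k
        using C(3)[OF d'(1-3)[of k], of Y] Y d[OF \<epsilon>[of k]] by (auto dest: order_trans)
      show "\<not> gap_bounds n0 H Y p"
      proof
        assume "gap_bounds n0 H Y p"
        then obtain \<delta>0 where \<delta>0: "0 < \<delta>0" "\<And>\<delta> n. 0 < \<delta> \<Longrightarrow> \<delta> \<le> \<delta>0 \<Longrightarrow> n0 \<delta> \<le> n \<Longrightarrow>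
            gamma_plus_graph (H \<delta> n) Y ?K \<le> 9 ^ 3"
          unfolding gap_bounds_def by auto
        obtain k where k: "1 / \<delta>0 < real k" using reals_Archimedean2 by blast
        have "\<epsilon> k \<le> \<delta>0"
          using k \<delta>0(1) by (simp add: \<epsilon>_def field_simps)
        then have "d (\<epsilon> k) \<le> \<delta>0" using d'(4)[of k] by linarith
        from \<delta>0(2)[OF d'(1) this d'(3)] big show False by blast
      qed
    qed
  qed
qed

text \<open>\<open>Y\<close> is the closure in \<open>S\<close> of the rational combinations of
  \<open>C\<close>; being closed, it is complete. Its cardinality is at most the continuum, which
  the injection \<open>h\<close> expresses.\<close>

lemma separable_subspace:
  fixes S :: "'v::real_vector set"
  assumes "banach_on S p" and C: "countable C" "C \<subseteq> S"
  obtains Y and h :: "'v \<Rightarrow> real" where "C \<subseteq> Y" "Y \<subseteq> S" "banach_on Y p" "inj_on h Y"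
proof -
  interpret banach_on S p by fact
  note S = subspace_0[OF subspace] subspace_add[OF subspace] subspace_diff[OF subspace]
    subspace_scale[OF subspace]
  \<comment> \<open>The inserted zero makes the enumerated set nonempty.\<close>
  define c where "c = from_nat_into (insert 0 C)"
  have cS: "c i \<in> S" for i
    using from_nat_into[of "insert 0 C" i] C(2) S(1) by (auto simp: c_def)
  have Cc: "C \<subseteq> range c"
    using C(1) from_nat_into_surj[of "insert 0 C"] by (fastforce simp: c_def)
  define comb :: "(nat \<times> rat) list \<Rightarrow> 'v" where
    "comb l = sum_list (map (\<lambda>(i, q). of_rat q *\<^sub>R c i) l)" for l
  have combS: "comb l \<in> S" for l
    by (induction l) (auto simp: comb_def S cS)
  have comb_append: "comb (l @ l') = comb l + comb l'" for l l'
    by (simp add: comb_def)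
  have comb_scale: "comb (map (\<lambda>(i, q). (i, r * q)) l) = of_rat r *\<^sub>R comb l" for r l
    by (induction l) (auto simp: comb_def scaleR_add_right of_rat_mult)
  define Y where "Y = {y \<in> S. \<forall>e>0. \<exists>l. p (y - comb l) < e}"
  have YS: "Y \<subseteq> S" by (auto simp: Y_def)
  have approx: "\<exists>l. p (y - comb l) < e" if "y \<in> Y" "0 < e" for y e
    using that by (simp add: Y_def)
  have CY: "C \<subseteq> Y"
  proof
    fix x assume "x \<in> C"
    then obtain i where i: "x = c i" using Cc by auto
    have "x - comb [(i, 1)] = 0" by (simp add: i comb_def)
    then have "p (x - comb [(i, 1)]) = 0" by (simp only: norm_0)
    then have "\<forall>e>0. \<exists>l. p (x - comb l) < e" by metis
    then show "x \<in> Y" using cS[of i] by (simp add: Y_def i)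
  qed
  have "subspace Y"
    unfolding subspace_def
  proof (intro conjI ballI allI)
    have "0 - comb [] = 0" by (simp add: comb_def)
    then have "p (0 - comb []) = 0" by (simp only: norm_0)
    then have "\<forall>e>0. \<exists>l. p (0 - comb l) < e" by metis
    then show "0 \<in> Y" using S(1) by (simp add: Y_def)
  next
    fix x y assume xy: "x \<in> Y" "y \<in> Y"
    then have xyS: "x \<in> S" "y \<in> S" using YS by auto
    show "x + y \<in> Y"
      unfolding Y_def
    proof (intro CollectI conjI allI impI)
      show "x + y \<in> S" using xyS S by auto
      fix e :: real assume "0 < e"
      then obtain l l' where l: "p (x - comb l) < e / 2" "p (y - comb l') < e / 2"
        using approx[OF xy(1), of "e / 2"] approx[OF xy(2), of "e / 2"] by auto
      have "x + y - comb (l @ l') = (x - comb l) + (y - comb l')"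
        by (simp add: comb_append)
      then have "p (x + y - comb (l @ l')) \<le> p (x - comb l) + p (y - comb l')"
        using norm_triangle xyS combS S(3) by metis
      with l have "p (x + y - comb (l @ l')) < e" by simp
      then show "\<exists>l. p (x + y - comb l) < e" ..
    qed
  next
    fix a :: real and x assume x: "x \<in> Y"
    then have xS: "x \<in> S" using YS by auto
    show "a *\<^sub>R x \<in> Y"
      unfolding Y_def
    proof (intro CollectI conjI allI impI)
      show "a *\<^sub>R x \<in> S" using xS S by auto
      fix e :: real assume e: "0 < e"
      define d where "d = e / (2 * (\<bar>a\<bar> + 1))"
      have d: "0 < d" "\<bar>a\<bar> * d \<le> e / 2"
        using e by (simp_all add: d_def field_simps)
      obtain l where l: "p (x - comb l) < d"
        using approx[OF x d(1)] by auto
      define b where "b = p (comb l) + 1"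
      have b: "0 < b" "p (comb l) < b"
        using norm_nonneg[OF combS] by (simp_all add: b_def add_nonneg_pos)
      obtain r where r: "a < of_rat r" "of_rat r < a + e / (2 * b)"
        using of_rat_dense[of a "a + e / (2 * b)"] e b by auto
      have "a *\<^sub>R x - of_rat r *\<^sub>R comb l = a *\<^sub>R (x - comb l) + (a - of_rat r) *\<^sub>R comb l"
        by (simp add: algebra_simps)
      then have "p (a *\<^sub>R x - of_rat r *\<^sub>R comb l) \<le> p (a *\<^sub>R (x - comb l)) + p ((a - of_rat r) *\<^sub>R comb l)"
        using norm_triangle xS combS S(3,4) by metis
      also have "\<dots> = \<bar>a\<bar> * p (x - comb l) + \<bar>a - of_rat r\<bar> * p (comb l)"
        using xS combS S by (simp add: norm_scale)
      also have "\<dots> < e / 2 + e / 2"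
      proof (rule add_le_less_mono)
        have "\<bar>a\<bar> * p (x - comb l) \<le> \<bar>a\<bar> * d" using l by (intro mult_left_mono) auto
        then show "\<bar>a\<bar> * p (x - comb l) \<le> e / 2" using d(2) by simp
        have "\<bar>a - of_rat r\<bar> * p (comb l) \<le> (e / (2 * b)) * p (comb l)"
          using r norm_nonneg[OF combS] by (intro mult_right_mono) auto
        also have "\<dots> < (e / (2 * b)) * b"
          using e b by (intro mult_strict_left_mono) auto
        also have "\<dots> = e / 2" using b by simp
        finally show "\<bar>a - of_rat r\<bar> * p (comb l) < e / 2" .
      qed
      finally have "p (a *\<^sub>R x - comb (map (\<lambda>(i, q). (i, r * q)) l)) < e"
        by (simp add: comb_scale)
      then show "\<exists>l. p (a *\<^sub>R x - comb l) < e" ..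
    qed
  qed
  moreover have "\<exists>l\<in>Y. (\<lambda>k. p (f k - l)) \<longlonglongrightarrow> 0"
    if f: "\<And>k. f k \<in> Y" and cauchy: "\<And>e. 0 < e \<Longrightarrow> \<exists>N. \<forall>i\<ge>N. \<forall>j\<ge>N. p (f i - f j) < e" for f
  proof -
    have fS: "f k \<in> S" for k using f YS by auto
    obtain l where l: "l \<in> S" "(\<lambda>k. p (f k - l)) \<longlonglongrightarrow> 0"
      using complete[OF fS cauchy] by auto
    have "\<exists>u. p (l - comb u) < e" if e: "0 < e" for e
    proof -
      have "\<forall>\<^sub>F k in sequentially. p (f k - l) < e / 2"
        using l(2) e by (intro order_tendstoD(2)) auto
      then obtain k where k: "p (f k - l) < e / 2"
        by (meson eventually_sequentially order_refl)
      obtain u where u: "p (f k - comb u) < e / 2"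
        using approx[OF f[of k], of "e / 2"] e by auto
      have "p (l - comb u) \<le> p (l - f k) + p (f k - comb u)"
        by (rule norm_diff_triangle[OF l(1) fS combS])
      with k u have "p (l - comb u) < e"
        using norm_minus_commute[OF l(1) fS[of k]] by simp
      then show ?thesis ..
    qed
    then have "l \<in> Y" using l(1) by (simp add: Y_def)
    with l(2) show ?thesis by auto
  qed
  ultimately have bY: "banach_on Y p"
    using YS by (unfold_locales)
      (auto intro: norm_nonneg norm_scale norm_triangle simp: norm_eq_0 subset_iff)
  \<comment> \<open>A point of \<open>Y\<close> is determined by the balls of radius 1 / (i + 1)
    around combinations that contain it, and there are countably many such balls.\<close>
  define enc :: "'v \<Rightarrow> nat set" where
    "enc y = {k. case from_nat k of (l, i :: nat) \<Rightarrow> p (y - comb l) < 1 / real (Suc i)}" for y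
  have "inj_on enc Y"
  proof (rule inj_onI)
    fix y z assume y: "y \<in> Y" and z: "z \<in> Y" and eq: "enc y = enc z"
    have yz: "y \<in> S" "z \<in> S" using y z YS by auto
    have small: "p (y - z) \<le> 2 * (1 / real (Suc i))" for i
    proof -
      obtain l where l: "p (y - comb l) < 1 / real (Suc i)"
        using approx[OF y, of "1 / real (Suc i)"] by auto
      then have "to_nat (l, i) \<in> enc y" by (simp add: enc_def)
      then have "p (z - comb l) < 1 / real (Suc i)"
        unfolding eq by (simp add: enc_def)
      with l show ?thesis
        using norm_diff_triangle[OF yz(1) combS yz(2), of l] norm_minus_commute[OF yz(2) combS, of l] by simp
    qed
    have "(\<lambda>i. 2 * (1 / real (Suc i))) \<longlonglongrightarrow> 2 * 0"
      by (intro tendsto_intros LIMSEQ_inverse_real_of_nat[unfolded inverse_eq_divide])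
    from LIMSEQ_le_const[OF this, of "p (y - z)"] small have "p (y - z) \<le> 2 * 0"
      by blast
    then show "y = z"
      using norm_nonneg[of "y - z"] norm_eq_0[of "y - z"] S(3)[OF yz] by simp
  qed
  moreover obtain b :: "nat set \<Rightarrow> real" where "inj b"
    using nat_sets_eqpoll_reals unfolding eqpoll_def bij_betw_def by auto
  ultimately have "inj_on (b \<circ> enc) Y"
    by (intro comp_inj_on) (auto intro: inj_on_subset)
  from that[OF CY YS bY this] show thesis .
qed

section \<open>Embedding into finitely supported functions and transport of the bounds\<close>

lemma lookup_scaleR: "Poly_Mapping.lookup (r *\<^sub>R x) i = r *\<^sub>R Poly_Mapping.lookup x i"
proof -
  have "finite {i. r *\<^sub>R Poly_Mapping.lookup x i \<noteq> 0}"
    by (rule finite_subset[OF _ finite_lookup[of x]]) auto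
  then show ?thesis
    by (simp add: scaleR_poly_mapping_def Abs_poly_mapping_inverse)
qed

lemma independent_single: "independent (range (\<lambda>r. Poly_Mapping.single r (1::real)))"
  unfolding independent_explicit_finite_subsets
proof (intro allI impI ballI)
  fix T :: "('a \<Rightarrow>\<^sub>0 real) set" and u v
  assume T: "T \<subseteq> range (\<lambda>r. Poly_Mapping.single r 1)" "finite T"
    and sum: "(\<Sum>v\<in>T. u v *\<^sub>R v) = 0" and v: "v \<in> T"
  obtain r where r: "v = Poly_Mapping.single r 1" using T v by auto
  have "0 = Poly_Mapping.lookup (\<Sum>v\<in>T. u v *\<^sub>R v) r" by (simp add: sum)
  also have "\<dots> = (\<Sum>w\<in>T. u w * Poly_Mapping.lookup w r)"
    by (simp add: lookup_sum lookup_scaleR)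
  also have "\<dots> = (\<Sum>w\<in>T. if w = v then u v else 0)"
  proof (intro sum.cong refl)
    fix w assume "w \<in> T"
    then obtain s where "w = Poly_Mapping.single s 1" using T by auto
    then have "Poly_Mapping.lookup w r = (if w = v then 1 else 0)"
      unfolding r by (metis lookup_single_eq lookup_single_not_eq)
    then show "u w * Poly_Mapping.lookup w r = (if w = v then u v else 0)" by simp
  qed
  also have "\<dots> = u v" using T v by simp
  finally show "u v = 0" by simp
qed

text \<open>A Hamel basis of \<open>Y\<close> is sent to unit vectors labelled by the reals
  \<open>h b\<close>. No continuity is asked for, as the norm is carried along afterwards.\<close>

lemma linear_embedding:
  fixes Y :: "'v::real_vector set" and h :: "'v \<Rightarrow> real"
  assumes "subspace Y" "inj_on h Y"
  obtains g :: "'v \<Rightarrow> (real \<Rightarrow>\<^sub>0 real)" where "linear g" "inj_on g Y"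
proof -
  obtain B where B: "B \<subseteq> Y" "independent B" "Y \<subseteq> span B"
    using maximal_independent_subset by blast
  obtain g :: "'v \<Rightarrow> (real \<Rightarrow>\<^sub>0 real)" where g: "linear g" "\<forall>b\<in>B. g b = Poly_Mapping.single (h b) 1"
    using linear_independent_extend[OF B(2), of "\<lambda>b. Poly_Mapping.single (h b) 1"] by auto
  have "inj_on g B"
  proof (rule inj_onI)
    fix x y assume xy: "x \<in> B" "y \<in> B" "g x = g y"
    then have "Poly_Mapping.lookup (Poly_Mapping.single (h x) (1::real)) (h x) =
        Poly_Mapping.lookup (Poly_Mapping.single (h y) 1) (h x)"
      using g(2) by simp
    then have "h x = h y" by (auto simp: lookup_single when_def split: if_splits)
    then show "x = y" using xy B(1) assms(2) by (auto dest: inj_onD)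
  qed
  moreover have "independent (g ` B)"
    by (rule independent_mono[OF independent_single]) (use g(2) in auto)
  ultimately have "inj_on g (span B)"
    using linear_inj_on_span_independent_image[OF g(1)] by blast
  then show thesis
    using that[OF g(1)] B(3) inj_on_subset by blast
qed

lemma gap_bounds_transfer:
  assumes "gap_bounds n0 H S' p'"
    and "\<And>\<delta> n. gamma_plus_graph (H \<delta> n) S (\<lambda>x y. (p (x - y))\<^sup>2) \<le>
      gamma_plus_graph (H \<delta> n) S' (\<lambda>x y. (p' (x - y))\<^sup>2)"
  shows "gap_bounds n0 H S p"
  using assms unfolding gap_bounds_def by (meson le_less_trans order_trans)

context
  fixes Y :: "'v::real_vector set" and p and g :: "'v \<Rightarrow> 'w::real_vector"
  assumes bY: "banach_on Y p" and lin: "linear g" and inj: "inj_on g Y"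
begin

interpretation banach_on Y p by (rule bY)

definition image_norm :: "'w \<Rightarrow> real" where
  "image_norm z = p (inv_into Y g z)"

lemma image_norm: "y \<in> Y \<Longrightarrow> image_norm (g y) = p y"
  by (simp add: image_norm_def inv_into_f_f[OF inj])

lemma image_norm_diff: "x \<in> Y \<Longrightarrow> y \<in> Y \<Longrightarrow> image_norm (g x - g y) = p (x - y)"
  using image_norm[of "x - y"] subspace_diff[OF subspace, of x y] by (simp add: linear_diff[OF lin])

lemma banach_on_image: "banach_on (g ` Y) image_norm"
proof
  show "subspace (g ` Y)" by (rule linear_subspace_image[OF lin subspace])
next
  fix f :: "nat \<Rightarrow> 'w" assume f: "\<And>k. f k \<in> g ` Y"
    and cauchy: "\<And>e. 0 < e \<Longrightarrow> \<exists>N. \<forall>i\<ge>N. \<forall>j\<ge>N. image_norm (f i - f j) < e"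
  have "\<exists>u. \<forall>k. u k \<in> Y \<and> f k = g (u k)" using f by (intro choice) auto
  then obtain u where u: "\<And>k. u k \<in> Y" "\<And>k. f k = g (u k)" by auto
  have "\<exists>l\<in>Y. (\<lambda>k. p (u k - l)) \<longlonglongrightarrow> 0"
    using cauchy u by (intro complete) (simp_all add: image_norm_diff)
  then obtain l where l: "l \<in> Y" "(\<lambda>k. p (u k - l)) \<longlonglongrightarrow> 0" by auto
  then show "\<exists>l\<in>g ` Y. (\<lambda>k. image_norm (f k - l)) \<longlonglongrightarrow> 0"
    using u by (intro bexI[of _ "g l"]) (simp_all add: image_norm_diff)
next
  fix x assume "x \<in> g ` Y"
  then obtain u where u: "u \<in> Y" "x = g u" by auto
  show "0 \<le> image_norm x" using u by (simp add: image_norm norm_nonneg)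
  have "g u = 0 \<longleftrightarrow> u = 0"
    using inj_onD[OF inj, of u 0] u subspace_0[OF subspace] linear_0[OF lin] by auto
  then show "image_norm x = 0 \<longleftrightarrow> x = 0" using u by (simp add: image_norm norm_eq_0)
  show "image_norm (a *\<^sub>R x) = \<bar>a\<bar> * image_norm x" for a
    using u image_norm[of "a *\<^sub>R u"] subspace_scale[OF subspace]
    by (simp add: linear_scale[OF lin] image_norm norm_scale)
  fix y assume "y \<in> g ` Y"
  then obtain v where v: "v \<in> Y" "y = g v" by auto
  show "image_norm (x + y) \<le> image_norm x + image_norm y"
    using u v image_norm[of "u + v"] subspace_add[OF subspace]
    by (simp add: linear_add[OF lin] image_norm norm_triangle)
qed

text \<open>The Rademacher projection consists of finite linear combinations and so commutes with
  \<open>g\<close>. Lifting a function from the image to \<open>Y\<close> therefore preserves both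
  norms in the quotient.\<close>

lemma K_const_image: "K_const (g ` Y) image_norm \<le> K_const Y p"
  unfolding K_const_def
proof (rule SUP_mono, rule bexI)
  fix n assume n: "n \<in> {1::nat..}"
  then show "n \<in> {1..}" .
  show "(SUP f\<in>cube n \<rightarrow> g ` Y. ereal (L2norm n image_norm (Rad n f) / L2norm n image_norm f))
      \<le> (SUP f\<in>cube n \<rightarrow> Y. ereal (L2norm n p (Rad n f) / L2norm n p f))"
  proof (rule SUP_mono)
    fix F assume F: "F \<in> cube n \<rightarrow> g ` Y"
    define f where "f = inv_into Y g \<circ> F"
    have f: "f \<in> cube n \<rightarrow> Y" and Ff: "\<And>e. e \<in> cube n \<Longrightarrow> F e = g (f e)"
      using F by (auto simp: f_def inv_into_into f_inv_into_f Pi_iff)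
    have fourier: "fourier n F j = g (fourier n f j)" for j
      unfolding fourier_def linear_scale[OF lin] linear_sum[OF lin]
      by (intro arg_cong2[where f = scaleR] sum.cong refl) (simp add: Ff linear_scale[OF lin])
    have Rad: "Rad n F e = g (Rad n f e)" for e
      by (simp add: Rad_def fourier linear_sum[OF lin] linear_scale[OF lin])
    have RadY: "Rad n f e \<in> Y" for e
      unfolding Rad_def fourier_def
      using f by (intro subspace_sum[OF subspace] subspace_scale[OF subspace]) auto
    have "L2norm n image_norm F = L2norm n p f"
      unfolding L2norm_def
      by (intro arg_cong[where f = sqrt] arg_cong2[where f = "(*)"] sum.cong refl)
        (simp add: Ff image_norm funcset_mem[OF f])
    moreover have "L2norm n image_norm (Rad n F) = L2norm n p (Rad n f)"
      by (simp add: L2norm_def Rad image_norm RadY)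
    ultimately show "\<exists>f\<in>cube n \<rightarrow> Y. ereal (L2norm n image_norm (Rad n F) / L2norm n image_norm F)
        \<le> ereal (L2norm n p (Rad n f) / L2norm n p f)"
      using f by auto
  qed
qed

lemma gamma_plus_image:
  "gamma_plus I A Y (\<lambda>x y. (p (x - y))\<^sup>2) \<le> gamma_plus I A (g ` Y) (\<lambda>x y. (image_norm (x - y))\<^sup>2)"
  unfolding gamma_plus_def
proof (rule Inf_superset_mono, clarify, intro exI conjI ballI)
  fix c x y
  assume *: "\<forall>x\<in>I \<rightarrow> g ` Y. \<forall>y\<in>I \<rightarrow> g ` Y.
      1 / (real (card I))\<^sup>2 * (\<Sum>i\<in>I. \<Sum>j\<in>I. (image_norm (x i - y j))\<^sup>2)
        \<le> c / real (card I) * (\<Sum>i\<in>I. \<Sum>j\<in>I. A i j * (image_norm (x i - y j))\<^sup>2)"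
    and xy: "x \<in> I \<rightarrow> Y" "y \<in> I \<rightarrow> Y"
  have eq: "image_norm (g (x i) - g (y j)) = p (x i - y j)" if "i \<in> I" "j \<in> I" for i j
    using xy that by (intro image_norm_diff) auto
  have "(g \<circ> x) \<in> I \<rightarrow> g ` Y" "(g \<circ> y) \<in> I \<rightarrow> g ` Y" using xy by auto
  with * have "1 / (real (card I))\<^sup>2 * (\<Sum>i\<in>I. \<Sum>j\<in>I. (image_norm ((g \<circ> x) i - (g \<circ> y) j))\<^sup>2)
        \<le> c / real (card I) * (\<Sum>i\<in>I. \<Sum>j\<in>I. A i j * (image_norm ((g \<circ> x) i - (g \<circ> y) j))\<^sup>2)"
    by blast
  then show "1 / (real (card I))\<^sup>2 * (\<Sum>i\<in>I. \<Sum>j\<in>I. (p (x i - y j))\<^sup>2)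
        \<le> c / real (card I) * (\<Sum>i\<in>I. \<Sum>j\<in>I. A i j * (p (x i - y j))\<^sup>2)"
    by (simp add: eq cong: sum.cong)
qed auto

end

lemma K_const_mono: "Y \<subseteq> S \<Longrightarrow> K_const Y p \<le> K_const S p"
  unfolding K_const_def by (rule SUP_mono, rule bexI) (auto intro!: SUP_subset_mono)

text \<open>K-convexity passes to the separable subspace and its isometric copy, where the family is
  good by assumption, while the countable set of witnesses makes the failure persist on that
  subspace.\<close>

lemma gap_bounds_good_family:
  fixes S :: "'v::real_vector set"
  assumes good: "good_family m n0 H" and "banach_on S p" "K_convex S p"
  shows "gap_bounds n0 H S p"
proof (rule ccontr)
  assume no: "\<not> gap_bounds n0 H S p"
  have fin: "finite (verts (H \<delta> n))" if \<delta>: "0 < \<delta>" "\<delta> < 1" "n0 \<delta> \<le> n" for \<delta> n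
  proof -
    have "\<forall>\<delta>\<in>{0<..1}. \<forall>n\<ge>n0 \<delta>. \<exists>d. regular_of_degree d (H \<delta> n)"
      using good unfolding good_family_def graph_family_def by blast
    then obtain d where "regular_of_degree d (H \<delta> n)"
      using \<delta> by (meson greaterThanAtMost_iff less_imp_le)
    then show ?thesis by (simp add: regular_of_degree_def is_mgraph_def)
  qed
  obtain C where C: "countable C" "C \<subseteq> S"
    "\<And>Y. C \<subseteq> Y \<Longrightarrow> Y \<subseteq> S \<Longrightarrow> \<not> gap_bounds n0 H Y p"
    by (rule gap_bounds_countable[OF _ no]) (assumption | rule fin that)+
  obtain Y and h :: "'v \<Rightarrow> real" where Y: "C \<subseteq> Y" "Y \<subseteq> S" "banach_on Y p" "inj_on h Y"
    by (rule separable_subspace[OF assms(2) C(1,2)]) (rule that)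
  obtain g :: "'v \<Rightarrow> (real \<Rightarrow>\<^sub>0 real)" where g: "linear g" "inj_on g Y"
    by (rule linear_embedding[OF banach_on.subspace[OF Y(3)] Y(4)]) (rule that)
  have "K_const (g ` Y) (image_norm Y p g) \<le> K_const S p"
    using K_const_image[OF Y(3) g] K_const_mono[OF Y(2), of p] by (rule order_trans)
  then have "K_convex (g ` Y) (image_norm Y p g)"
    using assms(3) unfolding K_convex_def by (rule le_less_trans)
  then have "gap_bounds n0 H (g ` Y) (image_norm Y p g)"
    using good banach_on_image[OF Y(3) g] by (simp add: good_family_def)
  then have "gap_bounds n0 H Y p"
    by (rule gap_bounds_transfer)
      (unfold gamma_plus_graph_def, rule gamma_plus_image[OF Y(3) g])
  with C(3)[OF Y(1,2)] show False by blast
qed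

theorem lemma1p12:
  shows "(\<exists>m n0 H. good_family m n0 H) \<and>
         (\<forall>m n0 H. good_family m n0 H \<longrightarrow>
            graph_family m n0 H \<and>
            (\<forall>(S :: 'v::real_vector set) p.
               banach_on S p \<longrightarrow> K_convex S p \<longrightarrow> gap_bounds n0 H S p))"
proof (intro conjI allI impI)
  have "good_family (\<lambda>n. 2 ^ n) threshold (\<lambda>\<delta> n. expander n (steps \<delta> n))"
    by (simp add: good_family_def graph_family_expander gap_bounds_expander)
  then show "\<exists>m n0 H. good_family m n0 H"
    by blast
next
  fix m n0 H assume good: "good_family m n0 H"
  then show "graph_family m n0 H"
    by (simp add: good_family_def)
  fix S :: "'v set" and p assume "banach_on S p" "K_convex S p"
  with good show "gap_bounds n0 H S p"
    by (rule gap_bounds_good_family)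
qed

end
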